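(* For every $x\ge 0$ the matrix $Z^{\uparrow}(0,x)$ is invertible. Further, for all $0\le x\le a$, $$Z^{\uparrow}(x,a)=Z^{\uparrow}(0,x)^{-1}\,Z^{\uparrow}(0,a).$$
   Context: Model. Let $E=\{1,\dots,m\}$; for each $i\in E$ let $c_i>0$, $\lambda_i>0$, $p_i\in(0,1)$, and let $Q=(q_{ij})_{i,j\in E}$ be a stochastic matrix. $(X,J)$ is the Markov process on $[0,\infty)\times E$ with the following dynamics: while the phase $J$ equals $i$, the level $X$ increases linearly with slope $1/c_i$ and the next jump occurs at rate $\lambda_i$ (so the holding time in between jumps is exponential with parameter $\lambda_i$); at a jump from $(x,i)$ the process moves to $(p_i x,j)$ with probability $q_{ij}$ ($j=i$ is allowed). $\mathbb P_{x,i},\mathbb E_{x,i}$ denote probability and expectation given $(X(0),J(0))=(x,i)$. Fix $w>0$. For $a\ge 0$ let $\tau_{\uparrow a}=\inf\{t\ge0: X(t)\ge a\}$. For $0\le x\le a$, $Z^{\uparrow}(x,a)$ is the $m\times m$ matrix with entries $$Z^{\uparrow}_{ij}(x,a)=\mathbb E_{x,i}\big[e^{-w\tau_{\uparrow a}};\,J(\tau_{\uparrow a})=j\big],$$ where $\mathbb E[Y;A]=\mathbb E[Y\mathbf 1_A]$ and the contribution of $\{\tau_{\uparrow a}=\infty\}$ is $0$. *)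

theory Defs
  imports "HOL-Probability.Probability"
begin

definition stochastic_matrix :: "real ^ 'e ^ 'e::finite \<Rightarrow> bool" where
  "stochastic_matrix Q \<longleftrightarrow> (\<forall>i j. 0 \<le> Q $ i $ j) \<and> (\<forall>i. (\<Sum>j\<in>UNIV. Q $ i $ j) = 1)"

text \<open>
  The type \<open>'e\<close> is the phase space. Under the probability measure \<open>M\<close>, the pair \<open>(X, J)\<close> is the
  level-phase process started in \<open>(x, i)\<close>, where \<open>T n\<close> is the time between the \<open>n\<close>-th and the
  \<open>n+1\<close>-st jump and \<open>Y n\<close> the phase during that period. A jump need not change the phase, and a
  jump from level 0 does not change the level, so the jumps cannot be read off the path \<open>(X, J)\<close>
  in general; this is why \<open>T\<close> and \<open>Y\<close> are separate data.

  The formula for \<open>measure M\<close> is the joint law of the phase chain and the holding times: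
  \<open>Y\<close> is a Markov chain with transition matrix \<open>Q\<close> started in \<open>i\<close>, and given \<open>Y\<close> the \<open>T n\<close> are
  independent and exponential with parameters \<open>lam (Y n)\<close>.

  Jump rates are bounded, so almost surely all \<open>T n\<close> are positive and their sum diverges. As usual
  for a process on the time axis \<open>[0, \<infinity>)\<close>, this is required of every path in \<open>space M\<close>:
  then \<open>X t\<close> and \<open>J t\<close> are determined by \<open>T\<close> and \<open>Y\<close> for all \<open>t \<ge> 0\<close>. The expression multiplied by
  \<open>p\<close> is the left limit of the level at the jump.
\<close>

definition process_with_jumps ::
  "('e::finite \<Rightarrow> real) \<Rightarrow> ('e \<Rightarrow> real) \<Rightarrow> ('e \<Rightarrow> real) \<Rightarrow> real ^ 'e ^ 'e \<Rightarrow> real \<Rightarrow> 'e \<Rightarrow>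
   'w measure \<Rightarrow> (real \<Rightarrow> 'w \<Rightarrow> real) \<Rightarrow> (real \<Rightarrow> 'w \<Rightarrow> 'e) \<Rightarrow>
   (nat \<Rightarrow> 'w \<Rightarrow> real) \<Rightarrow> (nat \<Rightarrow> 'w \<Rightarrow> 'e) \<Rightarrow> bool" where
  "process_with_jumps c lam p Q x i M X J T Y \<longleftrightarrow>
     prob_space M \<and>
     (\<forall>n. T n \<in> borel_measurable M) \<and>
     (\<forall>n. Y n \<in> measurable M (count_space UNIV)) \<and>
     (\<forall>n y t. (\<forall>k\<le>n. 0 \<le> t k) \<longrightarrow>
        measure M {\<omega> \<in> space M. \<forall>k\<le>n. Y k \<omega> = y k \<and> T k \<omega> > t k} =
        (if y 0 = i then 1 else 0) * (\<Prod>k<n. Q $ y k $ y (Suc k)) *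
        (\<Prod>k\<le>n. exp (- lam (y k) * t k))) \<and>
     (\<forall>\<omega>\<in>space M.
        let S = (\<lambda>n. \<Sum>k<n. T k \<omega>) in
          (\<forall>n. 0 < T n \<omega>) \<and>
          filterlim S at_top sequentially \<and>
          X 0 \<omega> = x \<and>
          (\<forall>n t. S n \<le> t \<and> t < S (Suc n) \<longrightarrow>
             J t \<omega> = Y n \<omega> \<and>
             X t \<omega> = X (S n) \<omega> + (t - S n) / c (Y n \<omega>)) \<and>
          (\<forall>n. X (S (Suc n)) \<omega> =
             p (Y n \<omega>) * (X (S n) \<omega> + T n \<omega> / c (Y n \<omega>))))"

definition level_phase_process ::
  "('e::finite \<Rightarrow> real) \<Rightarrow> ('e \<Rightarrow> real) \<Rightarrow> ('e \<Rightarrow> real) \<Rightarrow> real ^ 'e ^ 'e \<Rightarrow> real \<Rightarrow> 'e \<Rightarrow>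
   'w measure \<Rightarrow> (real \<Rightarrow> 'w \<Rightarrow> real) \<Rightarrow> (real \<Rightarrow> 'w \<Rightarrow> 'e) \<Rightarrow> bool" where
  "level_phase_process c lam p Q x i M X J \<longleftrightarrow>
     (\<exists>T Y. process_with_jumps c lam p Q x i M X J T Y)"

definition tau_up :: "(real \<Rightarrow> 'w \<Rightarrow> real) \<Rightarrow> real \<Rightarrow> 'w \<Rightarrow> ereal" where
  "tau_up X a \<omega> = Inf (ereal ` {t. 0 \<le> t \<and> a \<le> X t \<omega>})"

definition Z_up ::
  "real \<Rightarrow> (real \<Rightarrow> 'e::finite \<Rightarrow> 'w measure) \<Rightarrow> (real \<Rightarrow> 'w \<Rightarrow> real) \<Rightarrow> (real \<Rightarrow> 'w \<Rightarrow> 'e) \<Rightarrow>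
   real \<Rightarrow> real \<Rightarrow> real ^ 'e ^ 'e" where
  "Z_up w P X J x a = (\<chi> i j. \<integral>\<omega>.
     (if tau_up X a \<omega> < \<infinity> \<and> J (real_of_ereal (tau_up X a \<omega>)) \<omega> = j
      then exp (- w * real_of_ereal (tau_up X a \<omega>)) else 0) \<partial>P x i)"

end

theory Submission
  imports Defs
begin

text \<open>
  Conditioning on the first jump gives the renewal equation \<open>F = b + K F\<close> for the entries
  \<open>F i l = Z_up l a $ i $ j\<close>, where \<open>b\<close> is the contribution of reaching \<open>a\<close> before the first jump and
  \<open>K\<close> (called \<open>jump_op a\<close>) averages over one jump below \<open>a\<close>. The discount \<open>exp (- w * t)\<close> makes
  \<open>K\<close> a contraction in the supremum norm, so bounded solutions are unique. For \<open>x \<le> y \<le> a\<close>, both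
  \<open>Z_up x a\<close> and \<open>Z_up x y ** Z_up y a\<close>, as functions of \<open>x\<close> in \<open>[0, y]\<close>, solve the renewal equation
  with barrier \<open>y\<close> and the same inhomogeneous term, so they agree: no strong Markov property on path
  space is needed.

  All rows of \<open>Z_up x a\<close> sum to at most 1 and its diagonal entries are close to 1 when \<open>a - x\<close> is small,
  so then it is strictly diagonally dominant and invertible. In general \<open>Z_up 0 x\<close> is a product of such
  matrices.
\<close>

section \<open>Chains with exponential holding times\<close>

abbreviation exponential_measure :: "real \<Rightarrow> real measure" where
  "exponential_measure l \<equiv> density lborel (exponential_density l)"

lemma emeasure_exponential_greaterThan:
  assumes "0 < l"
  shows "emeasure (exponential_measure l) {t<..} = (if t < 0 then 1 else ennreal (exp (- l * t)))"
proof -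
  interpret E: prob_space "exponential_measure l"
    using assms by (rule prob_space_exponential_density)
  have "E.prob {..t} = (if t < 0 then 0 else 1 - exp (- l * t))"
    using assms by (simp add: measure_def emeasure_erlang_density erlang_CDF_def)
  moreover have "{t<..} = space (exponential_measure l) - {..t}"
    by auto
  ultimately have "E.prob {t<..} = (if t < 0 then 1 else exp (- l * t))"
    using E.prob_compl[of "{..t}"] by auto
  then show ?thesis
    by (auto simp: E.emeasure_eq_measure)
qed

text \<open>A joint law is determined by rectangles \<open>A \<times> B\<close>, and for fixed
  \<open>A\<close> both sides are finite measures in \<open>B\<close>, determined by their values on
  half-lines. In the application \<open>M\<close> is the underlying probability restricted to an
  event, and \<open>\<nu>\<close> is the law of \<open>V\<close> under this restriction.\<close>

lemma distr_pair_exponential: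
  assumes [measurable]: "V \<in> measurable M N" "T \<in> borel_measurable M"
    and "0 < l"
    and T_pos: "\<And>\<omega>. \<omega> \<in> space M \<Longrightarrow> 0 < T \<omega>"
    and "finite_measure \<nu>" and sets_\<nu>: "sets \<nu> = sets N"
    and tail: "\<And>A t. A \<in> sets N \<Longrightarrow> 0 \<le> t \<Longrightarrow>
      emeasure M {\<omega> \<in> space M. V \<omega> \<in> A \<and> t < T \<omega>} = emeasure \<nu> A * ennreal (exp (- l * t))"
  shows "distr M (N \<Otimes>\<^sub>M borel) (\<lambda>\<omega>. (V \<omega>, T \<omega>)) = \<nu> \<Otimes>\<^sub>M exponential_measure l"
proof (rule pair_measure_eqI[symmetric])
  interpret \<nu>: finite_measure \<nu> by fact
  interpret E: prob_space "exponential_measure l"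
    using \<open>0 < l\<close> by (rule prob_space_exponential_density)
  show "sigma_finite_measure \<nu>" "sigma_finite_measure (exponential_measure l)"
    by unfold_locales
  show "sets (\<nu> \<Otimes>\<^sub>M exponential_measure l) = sets (distr M (N \<Otimes>\<^sub>M borel) (\<lambda>\<omega>. (V \<omega>, T \<omega>)))"
    by (simp add: sets_\<nu> cong: sets_pair_measure_cong)
  fix A and B :: "real set"
  assume "A \<in> sets \<nu>" and "B \<in> sets (exponential_measure l)"
  then have [measurable]: "A \<in> sets N" "B \<in> sets borel"
    by (auto simp: sets_\<nu>)
  let ?D = "density M (\<lambda>\<omega>. indicator A (V \<omega>))"
  have D: "emeasure (distr ?D borel T) C = emeasure M {\<omega> \<in> space M. V \<omega> \<in> A \<and> T \<omega> \<in> C}"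
    if [measurable]: "C \<in> sets borel" for C
  proof -
    have "emeasure (distr ?D borel T) C =
        (\<integral>\<^sup>+\<omega>. indicator A (V \<omega>) * indicator (T -` C \<inter> space M) \<omega> \<partial>M)"
      by (simp add: emeasure_distr emeasure_density)
    also have "\<dots> = (\<integral>\<^sup>+\<omega>. indicator {\<omega> \<in> space M. V \<omega> \<in> A \<and> T \<omega> \<in> C} \<omega> \<partial>M)"
      by (intro nn_integral_cong) (auto split: split_indicator)
    finally show ?thesis
      by simp
  qed
  \<comment> \<open>The tail formula covers only \<open>t\<close> at least 0. For negative
    \<open>t\<close> both half-lines carry the full mass, and strict positivity of \<open>T\<close>
    reduces this case to \<open>t = 0\<close>.\<close>
  have greater: "emeasure (distr ?D borel T) {t<..} =
      emeasure (scale_measure (emeasure \<nu> A) (exponential_measure l)) {t<..}" for t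
  proof (cases "t < 0")
    case True
    then have "{\<omega> \<in> space M. V \<omega> \<in> A \<and> T \<omega> \<in> {t<..}} = {\<omega> \<in> space M. V \<omega> \<in> A \<and> 0 < T \<omega>}"
      using T_pos by fastforce
    then show ?thesis
      using tail[of A 0] True \<open>0 < l\<close> by (simp add: D emeasure_exponential_greaterThan)
  next
    case False
    then show ?thesis
      using tail[of A t] \<open>0 < l\<close> by (simp add: D emeasure_exponential_greaterThan)
  qed
  have "distr ?D borel T = scale_measure (emeasure \<nu> A) (exponential_measure l)"
    by (rule measure_eqI_lessThan)
      (auto simp: greater ennreal_mult_less_top less_top[symmetric] ennreal_mult_eq_top_iff)
  then have "emeasure \<nu> A * emeasure (exponential_measure l) B = emeasure (distr ?D borel T) B"
    by simp
  also have "\<dots> = emeasure M {\<omega> \<in> space M. V \<omega> \<in> A \<and> T \<omega> \<in> B}"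
    by (rule D) measurable
  also have "\<dots> = emeasure (distr M (N \<Otimes>\<^sub>M borel) (\<lambda>\<omega>. (V \<omega>, T \<omega>))) (A \<times> B)"
    by (subst emeasure_distr) (auto intro!: arg_cong[where f="emeasure M"])
  finally show "emeasure \<nu> A * emeasure (exponential_measure l) B =
      emeasure (distr M (N \<Otimes>\<^sub>M borel) (\<lambda>\<omega>. (V \<omega>, T \<omega>))) (A \<times> B)" .
qed

lemma nn_integral_split_finite:
  fixes Y :: "'w \<Rightarrow> 'e::finite"
  assumes [measurable]: "Y \<in> measurable M (count_space UNIV)" "\<And>i. f i \<in> borel_measurable M"
  shows "(\<integral>\<^sup>+\<omega>. f (Y \<omega>) \<omega> \<partial>M) = (\<Sum>i\<in>UNIV. \<integral>\<^sup>+\<omega>. indicator {i} (Y \<omega>) * f i \<omega> \<partial>M)"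
proof -
  have "f (Y \<omega>) \<omega> = (\<Sum>i\<in>UNIV. indicator {i} (Y \<omega>) * f i \<omega>)" for \<omega>
    by (subst sum.remove[of _ "Y \<omega>"]) (auto intro!: sum.neutral split: split_indicator)
  then have "(\<integral>\<^sup>+\<omega>. f (Y \<omega>) \<omega> \<partial>M) = (\<integral>\<^sup>+\<omega>. (\<Sum>i\<in>UNIV. indicator {i} (Y \<omega>) * f i \<omega>) \<partial>M)"
    by simp
  also have "\<dots> = (\<Sum>i\<in>UNIV. \<integral>\<^sup>+\<omega>. indicator {i} (Y \<omega>) * f i \<omega> \<partial>M)"
    by (rule nn_integral_sum) measurable
  finally show ?thesis .
qed

section \<open>The Markov property of a state driven by phases and holding times\<close>

locale holding_chain = prob_space M for M :: "'w measure" +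
  fixes lam :: "'e::finite \<Rightarrow> real" and Q :: "real ^ 'e ^ 'e" and i0 :: 'e
    and T :: "nat \<Rightarrow> 'w \<Rightarrow> real" and Y :: "nat \<Rightarrow> 'w \<Rightarrow> 'e"
  assumes lam_pos: "0 < lam i"
    and Q_stochastic: "stochastic_matrix Q"
    and T_measurable [measurable]: "T n \<in> borel_measurable M"
    and Y_measurable [measurable]: "Y n \<in> measurable M (count_space UNIV)"
    and T_pos: "\<omega> \<in> space M \<Longrightarrow> 0 < T n \<omega>"
    and law: "(\<And>k. k \<le> n \<Longrightarrow> 0 \<le> t k) \<Longrightarrow>
        measure M {\<omega> \<in> space M. \<forall>k\<le>n. Y k \<omega> = y k \<and> t k < T k \<omega>} =
        (if y 0 = i0 then 1 else 0) * (\<Prod>k<n. Q $ y k $ y (Suc k)) *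
        (\<Prod>k\<le>n. exp (- lam (y k) * t k))"

text \<open>\<open>V n\<close> is a function of the phases and holding times of the periods before
  the \<open>n\<close>-th, starting from the deterministic value \<open>v0\<close>. The Markov
  property is proved for such states in general; the later instance is the pair of level and
  discount.\<close>

locale recursive_state = holding_chain M lam Q i0 T Y
  for M :: "'w measure" and lam :: "'e::finite \<Rightarrow> real" and Q i0 T Y +
  fixes N :: "'v measure" and v0 :: 'v and \<phi> :: "'e \<Rightarrow> 'v \<times> real \<Rightarrow> 'v"
    and V :: "nat \<Rightarrow> 'w \<Rightarrow> 'v"
  assumes v0: "v0 \<in> space N"
    and \<phi>_measurable [measurable]: "\<phi> i \<in> measurable (N \<Otimes>\<^sub>M borel) N"
    and V_0: "V 0 \<omega> = v0"
    and V_Suc: "V (Suc n) \<omega> = \<phi> (Y n \<omega>) (V n \<omega>, T n \<omega>)"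
begin

lemma Q_nonneg: "0 \<le> Q $ i $ j"
  using Q_stochastic by (auto simp: stochastic_matrix_def)

lemma V_measurable [measurable]: "V n \<in> measurable M N"
proof (induction n)
  case 0
  show ?case
    using v0 by (simp add: V_0[abs_def])
next
  case (Suc n)
  note [measurable] = this
  have "(\<lambda>\<omega>. (\<lambda>i. \<phi> i (V n \<omega>, T n \<omega>)) (Y n \<omega>)) \<in> measurable M N"
    by (rule measurable_compose_countable) measurable
  then show ?case
    by (simp add: V_Suc[abs_def])
qed

text \<open>For nonnegative thresholds, the probability that a chain started in \<open>y 0\<close>
  runs through \<open>y 0, ..., y m\<close> with holding times exceeding
  \<open>t 0, ..., t m\<close>.\<close>

definition weight :: "nat \<Rightarrow> (nat \<Rightarrow> 'e) \<Rightarrow> (nat \<Rightarrow> real) \<Rightarrow> real" where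
  "weight m y t = (\<Prod>k<m. Q $ y k $ y (Suc k)) * (\<Prod>k\<le>m. exp (- lam (y k) * t k))"

lemma weight_nonneg: "0 \<le> weight m y t"
  by (simp add: weight_def Q_nonneg prod_nonneg)

lemma weight_Suc:
  "weight (Suc m) (case_nat i y) (case_nat s t) = Q $ i $ y 0 * weight m y t * exp (- lam i * s)"
  by (simp add: weight_def prod.lessThan_Suc_shift prod.atMost_Suc_shift
      del: prod.lessThan_Suc prod.atMost_Suc)

definition future :: "nat \<Rightarrow> nat \<Rightarrow> (nat \<Rightarrow> 'e) \<Rightarrow> (nat \<Rightarrow> real) \<Rightarrow> 'w set" where
  "future n m y t = {\<omega> \<in> space M. \<forall>k\<le>m. Y (n + k) \<omega> = y k \<and> t k < T (n + k) \<omega>}"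

lemma future_sets [measurable]: "future n m y t \<in> sets M"
  unfolding future_def by measurable

text \<open>As \<open>case_nat\<close> puts one period in front, a window from \<open>Suc n\<close>
  on together with a condition on period \<open>n\<close> becomes a window from \<open>n\<close> on.
  This links the Markov property at \<open>Suc n\<close> to that at \<open>n\<close>.\<close>

lemma future_Suc:
  "future n (Suc m) (case_nat i y) (case_nat s t) =
    {\<omega> \<in> future (Suc n) m y t. Y n \<omega> = i \<and> s < T n \<omega>}"
  by (auto simp: future_def less_Suc_eq_le[symmetric] All_less_Suc2)

lemma future_0: "future n 0 y (\<lambda>_. 0) = {\<omega> \<in> space M. Y n \<omega> = y 0}"
  using T_pos by (auto simp: future_def)

text \<open>The law of \<open>V n\<close> on the event that the \<open>n\<close>-th phase is
  \<open>i\<close>, left unnormalized: there is no division by the probability of that phase, which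
  may be 0.\<close>

definition phase_state :: "nat \<Rightarrow> 'e \<Rightarrow> 'v measure" where
  "phase_state n i = distr (density M (\<lambda>\<omega>. indicator {i} (Y n \<omega>))) N (V n)"

lemma sets_phase_state [simp, measurable_cong]: "sets (phase_state n i) = sets N"
  by (simp add: phase_state_def)

lemma emeasure_phase_state:
  assumes [measurable]: "A \<in> sets N"
  shows "emeasure (phase_state n i) A = emeasure M {\<omega> \<in> space M. V n \<omega> \<in> A \<and> Y n \<omega> = i}"
proof -
  have "emeasure (phase_state n i) A =
      (\<integral>\<^sup>+\<omega>. indicator {i} (Y n \<omega>) * indicator (V n -` A \<inter> space M) \<omega> \<partial>M)"
    by (simp add: phase_state_def emeasure_distr emeasure_density)
  also have "\<dots> = (\<integral>\<^sup>+\<omega>. indicator {\<omega> \<in> space M. V n \<omega> \<in> A \<and> Y n \<omega> = i} \<omega> \<partial>M)"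
    by (intro nn_integral_cong) (auto split: split_indicator)
  finally show ?thesis
    by simp
qed

lemma finite_phase_state: "finite_measure (phase_state n i)"
proof
  have "space (phase_state n i) = space N"
    by (simp add: phase_state_def)
  then show "emeasure (phase_state n i) (space (phase_state n i)) \<noteq> \<infinity>"
    by (simp add: emeasure_phase_state)
qed

lemma nn_integral_phase_state:
  assumes [measurable]: "f \<in> borel_measurable N"
  shows "(\<integral>\<^sup>+v. f v \<partial>phase_state n i) = (\<integral>\<^sup>+\<omega>. indicator {i} (Y n \<omega>) * f (V n \<omega>) \<partial>M)"
  by (simp add: phase_state_def nn_integral_distr nn_integral_density)

text \<open>The Markov property as a product formula: given the current phase, the state is
  independent of the periods from \<open>n\<close> on, and these have the law of a fresh chain. The
  bound \<open>m\<close> is arbitrary because the induction step uses a window longer by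
  one.\<close>

definition markov_at :: "nat \<Rightarrow> bool" where
  "markov_at n \<longleftrightarrow> (\<forall>A m y t. A \<in> sets N \<longrightarrow> (\<forall>k\<le>m. 0 \<le> t k) \<longrightarrow>
     emeasure M {\<omega> \<in> future n m y t. V n \<omega> \<in> A} =
     emeasure (phase_state n (y 0)) A * ennreal (weight m y t))"

text \<open>The tail event of \<open>T n\<close> is one more coordinate of a window, so
  \<open>markov_at n\<close> with bound \<open>Suc m\<close> shows that on the event in question
  \<open>V n\<close> and \<open>T n\<close> have a product law with an exponential factor.\<close>

lemma nn_integral_markov_at:
  assumes "markov_at n" and t: "\<forall>k\<le>m. 0 \<le> t k"
    and [measurable]: "f \<in> borel_measurable (N \<Otimes>\<^sub>M borel)"
  shows "(\<integral>\<^sup>+\<omega>. indicator {\<omega> \<in> future (Suc n) m y t. Y n \<omega> = i} \<omega> * f (V n \<omega>, T n \<omega>) \<partial>M) =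
    ennreal (Q $ i $ y 0 * weight m y t) *
      (\<integral>\<^sup>+v. \<integral>\<^sup>+s. f (v, s) \<partial>exponential_measure (lam i) \<partial>phase_state n i)"
proof -
  interpret E: prob_space "exponential_measure (lam i)"
    by (rule prob_space_exponential_density[OF lam_pos])
  let ?c = "ennreal (Q $ i $ y 0 * weight m y t)"
  let ?F = "{\<omega> \<in> future (Suc n) m y t. Y n \<omega> = i}"
  let ?\<nu> = "scale_measure ?c (phase_state n i)"
  have F [measurable]: "?F \<in> sets M"
    by (simp add: future_def)
  have "distr (density M (indicator ?F)) (N \<Otimes>\<^sub>M borel) (\<lambda>\<omega>. (V n \<omega>, T n \<omega>)) =
      ?\<nu> \<Otimes>\<^sub>M exponential_measure (lam i)"
  proof (rule distr_pair_exponential)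
    show "finite_measure ?\<nu>"
      using finite_measure.finite_emeasure_space[OF finite_phase_state]
      by (intro finite_measureI) (simp add: ennreal_mult_eq_top_iff space_scale_measure)
    fix A and s :: real assume [measurable]: "A \<in> sets N" and "0 \<le> s"
    have "emeasure (density M (indicator ?F))
          {\<omega> \<in> space (density M (indicator ?F)). V n \<omega> \<in> A \<and> s < T n \<omega>} =
        (\<integral>\<^sup>+\<omega>. indicator ?F \<omega> * indicator {\<omega> \<in> space M. V n \<omega> \<in> A \<and> s < T n \<omega>} \<omega> \<partial>M)"
      by (simp add: emeasure_density)
    also have "\<dots> = (\<integral>\<^sup>+\<omega>. indicator
        {\<omega> \<in> future n (Suc m) (case_nat i y) (case_nat s t). V n \<omega> \<in> A} \<omega> \<partial>M)"
      by (intro nn_integral_cong) (auto simp: future_Suc split: split_indicator)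
    also have "\<dots> = emeasure (phase_state n i) A * ennreal (weight (Suc m) (case_nat i y) (case_nat s t))"
      using \<open>markov_at n\<close> t \<open>0 \<le> s\<close>
      by (simp add: markov_at_def less_Suc_eq_le[symmetric] All_less_Suc2)
    also have "\<dots> = emeasure ?\<nu> A * ennreal (exp (- lam i * s))"
      by (simp add: weight_Suc ennreal_mult Q_nonneg weight_nonneg mult_ac)
    finally show "emeasure (density M (indicator ?F))
          {\<omega> \<in> space (density M (indicator ?F)). V n \<omega> \<in> A \<and> s < T n \<omega>} =
        emeasure ?\<nu> A * ennreal (exp (- lam i * s))" .
  qed (auto simp: T_pos lam_pos)
  moreover have "(\<integral>\<^sup>+\<omega>. indicator ?F \<omega> * f (V n \<omega>, T n \<omega>) \<partial>M) =
      (\<integral>\<^sup>+x. f x \<partial>distr (density M (indicator ?F)) (N \<Otimes>\<^sub>M borel) (\<lambda>\<omega>. (V n \<omega>, T n \<omega>)))"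
    by (simp add: nn_integral_distr nn_integral_density)
  ultimately have "(\<integral>\<^sup>+\<omega>. indicator ?F \<omega> * f (V n \<omega>, T n \<omega>) \<partial>M) =
      (\<integral>\<^sup>+v. \<integral>\<^sup>+s. f (v, s) \<partial>exponential_measure (lam i) \<partial>?\<nu>)"
    by (simp add: E.nn_integral_fst[symmetric])
  also have "\<dots> = ?c * (\<integral>\<^sup>+v. \<integral>\<^sup>+s. f (v, s) \<partial>exponential_measure (lam i) \<partial>phase_state n i)"
    by (simp add: nn_integral_scale_measure)
  finally show ?thesis .
qed

text \<open>Induction on \<open>n\<close>. For 0 the state is constant and the formula is
  \<open>law\<close>. In the step, summing over the phase of period \<open>n\<close> expresses the
  new state through \<open>V n\<close> and \<open>T n\<close>, whose joint law on the window is
  known.\<close>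

lemma markov_at: "markov_at n"
proof (induction n)
  case 0
  show ?case
    unfolding markov_at_def
  proof (intro allI impI)
    fix A m y and t :: "nat \<Rightarrow> real" assume "A \<in> sets N" and t: "\<forall>k\<le>m. 0 \<le> t k"
    have "emeasure M (future 0 m y t) = ennreal ((if y 0 = i0 then 1 else 0) * weight m y t)"
      using law[of m t y] t by (simp add: future_def weight_def emeasure_eq_measure)
    moreover have "emeasure M {\<omega> \<in> space M. Y 0 \<omega> = y 0} = (if y 0 = i0 then 1 else 0)"
      using law[of 0 "\<lambda>_. 0" y] by (simp add: emeasure_eq_measure T_pos cong: conj_cong)
    ultimately show "emeasure M {\<omega> \<in> future 0 m y t. V 0 \<omega> \<in> A} =
        emeasure (phase_state 0 (y 0)) A * ennreal (weight m y t)"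
      using \<open>A \<in> sets N\<close> by (cases "v0 \<in> A") (auto simp: emeasure_phase_state V_0)
  qed
next
  case (Suc n)
  \<comment> \<open>Up to the factor \<open>weight m y t\<close>, the mass of the new state depends
    on the window only through its first phase; \<open>R A j\<close> is this remaining part.\<close>
  define R where "R A j = (\<Sum>i\<in>UNIV. ennreal (Q $ i $ j) * (\<integral>\<^sup>+v. \<integral>\<^sup>+s. indicator A (\<phi> i (v, s))
    \<partial>exponential_measure (lam i) \<partial>phase_state n i))" for A j
  have R: "emeasure M {\<omega> \<in> future (Suc n) m y t. V (Suc n) \<omega> \<in> A} = R A (y 0) * ennreal (weight m y t)"
    if [measurable]: "A \<in> sets N" and t: "\<forall>k\<le>m. 0 \<le> t k" for A m y t
  proof -
    have "emeasure M {\<omega> \<in> future (Suc n) m y t. V (Suc n) \<omega> \<in> A} =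
      (\<integral>\<^sup>+\<omega>. indicator (future (Suc n) m y t) \<omega> * indicator A (\<phi> (Y n \<omega>) (V n \<omega>, T n \<omega>)) \<partial>M)"
    proof -
      have "emeasure M {\<omega> \<in> future (Suc n) m y t. V (Suc n) \<omega> \<in> A} =
          (\<integral>\<^sup>+\<omega>. indicator {\<omega> \<in> future (Suc n) m y t. V (Suc n) \<omega> \<in> A} \<omega> \<partial>M)"
        by (subst nn_integral_indicator) (auto simp: future_def)
      also have "\<dots> = (\<integral>\<^sup>+\<omega>. indicator (future (Suc n) m y t) \<omega> *
          indicator A (\<phi> (Y n \<omega>) (V n \<omega>, T n \<omega>)) \<partial>M)"
        by (intro nn_integral_cong) (auto simp: V_Suc split: split_indicator)
      finally show ?thesis .
    qed
    also have "\<dots> = (\<Sum>i\<in>UNIV. \<integral>\<^sup>+\<omega>. indicator {i} (Y n \<omega>) *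
        (indicator (future (Suc n) m y t) \<omega> * indicator A (\<phi> i (V n \<omega>, T n \<omega>))) \<partial>M)"
      by (rule nn_integral_split_finite) measurable
    also have "\<dots> = (\<Sum>i\<in>UNIV. \<integral>\<^sup>+\<omega>. indicator {\<omega> \<in> future (Suc n) m y t. Y n \<omega> = i} \<omega> *
        indicator A (\<phi> i (V n \<omega>, T n \<omega>)) \<partial>M)"
      by (intro sum.cong nn_integral_cong) (auto split: split_indicator)
    also have "\<dots> = R A (y 0) * ennreal (weight m y t)"
      unfolding R_def sum_distrib_right
      by (intro sum.cong refl, subst nn_integral_markov_at[OF Suc t])
        (auto simp: ennreal_mult Q_nonneg weight_nonneg mult_ac)
    finally show ?thesis .
  qed
  \<comment> \<open>The window of a single period with threshold 0 has weight 1 and identifies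
    \<open>R\<close> as the unnormalized law of the new state.\<close>
  have "emeasure (phase_state (Suc n) j) A = R A j" if "A \<in> sets N" for A j
  proof -
    have "{\<omega> \<in> space M. V (Suc n) \<omega> \<in> A \<and> Y (Suc n) \<omega> = j} =
        {\<omega> \<in> future (Suc n) 0 (\<lambda>_. j) (\<lambda>_. 0). V (Suc n) \<omega> \<in> A}"
      by (auto simp: future_0)
    then show ?thesis
      using R[OF that, of 0 "\<lambda>_. 0" "\<lambda>_. j"] that
      by (simp add: emeasure_phase_state weight_def)
  qed
  then show ?case
    by (simp add: markov_at_def R)
qed

text \<open>Given phase and state at period \<open>n\<close>, the holding time is exponential and
  the next phase is drawn independently of it from the row of \<open>Q\<close>. Later sections use
  the Markov property only in this form.\<close>

lemma nn_integral_step: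
  assumes [measurable]: "\<And>i j. f i j \<in> borel_measurable (N \<Otimes>\<^sub>M borel)"
  shows "(\<integral>\<^sup>+\<omega>. f (Y n \<omega>) (Y (Suc n) \<omega>) (V n \<omega>, T n \<omega>) \<partial>M) =
    (\<integral>\<^sup>+\<omega>. (\<Sum>j\<in>UNIV. ennreal (Q $ Y n \<omega> $ j) *
      (\<integral>\<^sup>+s. f (Y n \<omega>) j (V n \<omega>, s) \<partial>exponential_measure (lam (Y n \<omega>)))) \<partial>M)"
proof -
  have E: "sigma_finite_measure (exponential_measure (lam i))" for i
    using prob_space_exponential_density[OF lam_pos]
    by (simp add: prob_space_imp_sigma_finite)
  let ?I = "\<lambda>i j v. \<integral>\<^sup>+s. f i j (v, s) \<partial>exponential_measure (lam i)"
  have I [measurable]: "?I i j \<in> borel_measurable N" for i j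
    by (rule sigma_finite_measure.borel_measurable_nn_integral_fst[OF E]) simp
  have [measurable]: "(\<lambda>\<omega>. f (Y n \<omega>) j (V n \<omega>, T n \<omega>)) \<in> borel_measurable M" for j
    by (rule measurable_compose_countable[where f = "\<lambda>i \<omega>. f i j (V n \<omega>, T n \<omega>)"]) measurable
  have "(\<integral>\<^sup>+\<omega>. f (Y n \<omega>) (Y (Suc n) \<omega>) (V n \<omega>, T n \<omega>) \<partial>M) =
      (\<Sum>j\<in>UNIV. \<integral>\<^sup>+\<omega>. indicator {j} (Y (Suc n) \<omega>) * f (Y n \<omega>) j (V n \<omega>, T n \<omega>) \<partial>M)"
    by (rule nn_integral_split_finite[where f = "\<lambda>j \<omega>. f (Y n \<omega>) j (V n \<omega>, T n \<omega>)"]) measurable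
  also have "\<dots> = (\<Sum>j\<in>UNIV. \<Sum>i\<in>UNIV. \<integral>\<^sup>+\<omega>. indicator {i} (Y n \<omega>) *
      (indicator {j} (Y (Suc n) \<omega>) * f i j (V n \<omega>, T n \<omega>)) \<partial>M)"
    by (intro sum.cong refl nn_integral_split_finite) measurable
  also have "\<dots> = (\<Sum>j\<in>UNIV. \<Sum>i\<in>UNIV. ennreal (Q $ i $ j) * (\<integral>\<^sup>+v. ?I i j v \<partial>phase_state n i))"
  proof (intro sum.cong refl)
    fix i j
    have "(\<integral>\<^sup>+\<omega>. indicator {i} (Y n \<omega>) * (indicator {j} (Y (Suc n) \<omega>) * f i j (V n \<omega>, T n \<omega>)) \<partial>M) =
        (\<integral>\<^sup>+\<omega>. indicator {\<omega> \<in> future (Suc n) 0 (\<lambda>_. j) (\<lambda>_. 0). Y n \<omega> = i} \<omega> *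
          f i j (V n \<omega>, T n \<omega>) \<partial>M)"
      unfolding future_0 by (intro nn_integral_cong) (auto split: split_indicator)
    also have "\<dots> = ennreal (Q $ i $ j) * (\<integral>\<^sup>+v. ?I i j v \<partial>phase_state n i)"
      by (subst nn_integral_markov_at[OF markov_at]) (auto simp: weight_def)
    finally show "(\<integral>\<^sup>+\<omega>. indicator {i} (Y n \<omega>) * (indicator {j} (Y (Suc n) \<omega>) * f i j (V n \<omega>, T n \<omega>)) \<partial>M) =
      ennreal (Q $ i $ j) * (\<integral>\<^sup>+v. ?I i j v \<partial>phase_state n i)" .
  qed
  also have "\<dots> = (\<Sum>i\<in>UNIV. \<Sum>j\<in>UNIV. ennreal (Q $ i $ j) * (\<integral>\<^sup>+v. ?I i j v \<partial>phase_state n i))"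
    by (rule sum.swap)
  also have "\<dots> = (\<Sum>i\<in>UNIV. \<integral>\<^sup>+v. (\<Sum>j\<in>UNIV. ennreal (Q $ i $ j) * ?I i j v) \<partial>phase_state n i)"
    by (intro sum.cong refl, subst nn_integral_sum) (auto simp: nn_integral_cmult)
  also have "\<dots> = (\<Sum>i\<in>UNIV. \<integral>\<^sup>+\<omega>. indicator {i} (Y n \<omega>) *
      (\<Sum>j\<in>UNIV. ennreal (Q $ i $ j) * ?I i j (V n \<omega>)) \<partial>M)"
    by (intro sum.cong refl nn_integral_phase_state) measurable
  also have "\<dots> = (\<integral>\<^sup>+\<omega>. (\<Sum>j\<in>UNIV. ennreal (Q $ Y n \<omega> $ j) * ?I (Y n \<omega>) j (V n \<omega>)) \<partial>M)"
    by (rule nn_integral_split_finite[symmetric]) measurable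
  finally show ?thesis .
qed

end

section \<open>The renewal equation\<close>

lemma AE_exponential_nonneg: "AE s in exponential_measure l. 0 \<le> s"
  by (auto simp: AE_density exponential_density_def)

text \<open>Multiplying the exponential density by \<open>exp (- w * s)\<close> gives a multiple of
  the density with parameter \<open>l + w\<close>.\<close>

lemma nn_integral_exponential_exp:
  assumes "0 < l" "0 < w"
  shows "(\<integral>\<^sup>+s. ennreal (exp (- w * s)) \<partial>exponential_measure l) = ennreal (l / (l + w))"
proof -
  interpret E: prob_space "exponential_measure (l + w)"
    using assms by (intro prob_space_exponential_density) simp
  have "(\<integral>\<^sup>+s. ennreal (exp (- w * s)) \<partial>exponential_measure l) =
      (\<integral>\<^sup>+s. ennreal (l / (l + w)) * ennreal (exponential_density (l + w) s) \<partial>lborel)"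
    using assms
    by (auto simp: nn_integral_density exponential_density_def ennreal_mult'[symmetric]
        exp_add[symmetric] field_simps intro!: nn_integral_cong)
  also have "\<dots> = ennreal (l / (l + w)) * (\<integral>\<^sup>+s. 1 \<partial>exponential_measure (l + w))"
    by (simp add: nn_integral_cmult nn_integral_density del: nn_integral_const)
  also have "\<dots> = ennreal (l / (l + w))"
    using E.emeasure_space_1 by simp
  finally show ?thesis .
qed

lemma nn_integral_exponential_memoryless:
  assumes "0 < l" "0 \<le> d" and [measurable]: "h \<in> borel_measurable borel"
  shows "(\<integral>\<^sup>+s. (if d < s then h s else 0) \<partial>exponential_measure l) =
    ennreal (exp (- l * d)) * (\<integral>\<^sup>+s. h (s + d) \<partial>exponential_measure l)"
proof -
  have "(\<integral>\<^sup>+s. (if d < s then h s else 0) \<partial>exponential_measure l) =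
      (\<integral>\<^sup>+s. ennreal (exponential_density l s) * (if d < s then h s else 0) \<partial>lborel)"
    by (simp add: nn_integral_density)
  also have "\<dots> = (\<integral>\<^sup>+s. ennreal (exponential_density l (d + s)) * (if 0 < s then h (d + s) else 0) \<partial>lborel)"
    by (subst nn_integral_real_affine[where c = 1 and t = d]) (auto cong: if_cong)
  \<comment> \<open>At \<open>s = 0\<close> the integrands may differ, since the left one vanishes
    there while the density on the right does not; this null set is left out.\<close>
  also have "\<dots> = (\<integral>\<^sup>+s. ennreal (exp (- l * d)) * (ennreal (exponential_density l s) * h (s + d)) \<partial>lborel)"
  proof (rule nn_integral_cong_AE, use AE_lborel_singleton[of 0] in eventually_elim)
    fix s :: real assume "s \<noteq> 0"
    have "exponential_density l (d + s) = exp (- l * d) * exponential_density l s" if "0 < s"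
      using that \<open>0 \<le> d\<close> by (simp add: exponential_density_def exp_add[symmetric] algebra_simps)
    moreover have "exponential_density l s = 0" if "s < 0"
      using that by (simp add: exponential_density_def)
    ultimately show "ennreal (exponential_density l (d + s)) * (if 0 < s then h (d + s) else 0) =
        ennreal (exp (- l * d)) * (ennreal (exponential_density l s) * h (s + d))"
      using \<open>s \<noteq> 0\<close> by (cases "0 < s") (auto simp: ennreal_mult' mult.assoc add.commute)
  qed
  also have "\<dots> = ennreal (exp (- l * d)) * (\<integral>\<^sup>+s. h (s + d) \<partial>exponential_measure l)"
    by (simp add: nn_integral_cmult nn_integral_density)
  finally show ?thesis .
qed

section \<open>The one-jump operator and its Neumann series\<close>

locale level_model =
  fixes c lam p :: "'e::finite \<Rightarrow> real" and Q :: "real ^ 'e ^ 'e" and w :: real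
  assumes c_pos: "0 < c i"
    and lam_pos: "0 < lam i"
    and p_pos: "0 < p i"
    and p_less_1: "p i < 1"
    and Q_stochastic: "stochastic_matrix Q"
    and w_pos: "0 < w"
begin

lemma Q_nonneg: "0 \<le> Q $ i $ j"
  using Q_stochastic by (auto simp: stochastic_matrix_def)

lemma Q_sum: "(\<Sum>j\<in>UNIV. ennreal (Q $ i $ j)) = 1"
  using Q_stochastic by (subst sum_ennreal) (auto simp: stochastic_matrix_def)

lemma prob_space_holding: "prob_space (exponential_measure (lam i))"
  by (rule prob_space_exponential_density[OF lam_pos])

definition after_jump :: "('e \<Rightarrow> real \<Rightarrow> ennreal) \<Rightarrow> 'e \<Rightarrow> real \<Rightarrow> ennreal" where
  "after_jump h i l = (\<Sum>j\<in>UNIV. ennreal (Q $ i $ j) * h j (p i * l))"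

text \<open>Takes values in \<open>ennreal\<close>, so sums and integrals exist without
  integrability conditions. The non-strict comparison concerns the left limit of the level at the
  jump: if it equals \<open>a\<close>, the level \<open>a\<close> has not been attained in that
  period.\<close>

definition jump_op :: "real \<Rightarrow> ('e \<Rightarrow> real \<Rightarrow> ennreal) \<Rightarrow> 'e \<Rightarrow> real \<Rightarrow> ennreal" where
  "jump_op a h i l = (\<integral>\<^sup>+s. (if l + s / c i \<le> a
     then ennreal (exp (- w * s)) * after_jump h i (l + s / c i) else 0) \<partial>exponential_measure (lam i))"

text \<open>Complements the condition in \<open>jump_op\<close>: for \<open>l \<le> a\<close>, the
  level \<open>a\<close> is reached after time \<open>c i * (a - l)\<close>, before the jump and
  still in phase \<open>i\<close>.\<close>

definition exit_weight :: "'e \<Rightarrow> real \<Rightarrow> 'e \<Rightarrow> real \<Rightarrow> real \<Rightarrow> ennreal" where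
  "exit_weight j a i l s =
    (if i = j \<and> a < l + s / c i then ennreal (exp (- w * (c i * (a - l)))) else 0)"

definition exit_now :: "'e \<Rightarrow> real \<Rightarrow> 'e \<Rightarrow> real \<Rightarrow> ennreal" where
  "exit_now j a i l = (\<integral>\<^sup>+s. exit_weight j a i l s \<partial>exponential_measure (lam i))"

text \<open>The Neumann series of the renewal equation. Its \<open>n\<close>-th term is the
  contribution of reaching \<open>a\<close> after exactly \<open>n\<close> jumps.\<close>

definition passage :: "'e \<Rightarrow> real \<Rightarrow> 'e \<Rightarrow> real \<Rightarrow> ennreal" where
  "passage j a i l = (\<Sum>n. (jump_op a ^^ n) (exit_now j a) i l)"

lemma after_jump_measurable [measurable]:
  assumes [measurable]: "\<And>i. h i \<in> borel_measurable borel"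
  shows "after_jump h i \<in> borel_measurable borel"
  unfolding after_jump_def by measurable

lemma exit_weight_measurable [measurable]:
  "case_prod (exit_weight j a i) \<in> borel_measurable (borel \<Otimes>\<^sub>M borel)"
  unfolding exit_weight_def by measurable

lemma exit_now_measurable [measurable]: "exit_now j a i \<in> borel_measurable borel"
proof -
  interpret E: prob_space "exponential_measure (lam i)"
    by (rule prob_space_holding)
  show ?thesis
    unfolding exit_now_def[abs_def]
    by (rule E.borel_measurable_nn_integral) measurable
qed

lemma jump_op_measurable [measurable]:
  assumes [measurable]: "\<And>i. h i \<in> borel_measurable borel"
  shows "jump_op a h i \<in> borel_measurable borel"
proof -
  interpret E: prob_space "exponential_measure (lam i)"
    by (rule prob_space_holding)
  show ?thesis
    unfolding jump_op_def[abs_def]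
    by (rule E.borel_measurable_nn_integral) measurable
qed

lemma jump_op_funpow_measurable [measurable]:
  assumes "\<And>i. h i \<in> borel_measurable borel"
  shows "(jump_op a ^^ n) h i \<in> borel_measurable borel"
  by (induction n arbitrary: i) (auto intro!: assms jump_op_measurable)

lemma passage_measurable [measurable]: "passage j a i \<in> borel_measurable borel"
  unfolding passage_def[abs_def] by (rule borel_measurable_suminf_order) measurable

lemma jump_op_suminf:
  assumes [measurable]: "\<And>n i. h n i \<in> borel_measurable borel"
  shows "jump_op a (\<lambda>i l. \<Sum>n. h n i l) i l = (\<Sum>n. jump_op a (h n) i l)"
proof -
  have "after_jump (\<lambda>i l. \<Sum>n. h n i l) i l' = (\<Sum>n. after_jump (h n) i l')" for l'
    by (simp add: after_jump_def ennreal_suminf_cmult[symmetric] suminf_sum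
        del: ennreal_suminf_cmult)
  then show ?thesis
    unfolding jump_op_def
    by (subst nn_integral_suminf[symmetric])
      (auto intro!: nn_integral_cong simp: ennreal_suminf_cmult)
qed

lemma jump_op_add:
  assumes [measurable]: "\<And>i. f i \<in> borel_measurable borel" "\<And>i. g i \<in> borel_measurable borel"
  shows "jump_op a (\<lambda>i l. f i l + g i l) i l = jump_op a f i l + jump_op a g i l"
  unfolding jump_op_def
  by (subst nn_integral_add[symmetric])
    (auto intro!: nn_integral_cong simp: after_jump_def distrib_left sum.distrib)

lemma jump_op_mult_right:
  assumes [measurable]: "\<And>i. f i \<in> borel_measurable borel"
  shows "jump_op a (\<lambda>i l. f i l * r) i l = jump_op a f i l * r"
proof -
  have "after_jump (\<lambda>i l. f i l * r) i l' = after_jump f i l' * r" for l'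
    by (simp add: after_jump_def sum_distrib_right mult.assoc)
  then show ?thesis
    unfolding jump_op_def
    by (subst nn_integral_multc[symmetric]) (auto intro!: nn_integral_cong simp: mult.assoc)
qed

lemma jump_op_sum:
  assumes [measurable]: "\<And>k i. f k i \<in> borel_measurable borel"
  shows "jump_op a (\<lambda>i l. \<Sum>k\<in>A. f k i l) i l = (\<Sum>k\<in>A. jump_op a (f k) i l)"
proof -
  have "after_jump (\<lambda>i l. \<Sum>k\<in>A. f k i l) i l' = (\<Sum>k\<in>A. after_jump (f k) i l')" for l'
    unfolding after_jump_def sum_distrib_left by (rule sum.swap)
  then show ?thesis
    unfolding jump_op_def
    by (subst nn_integral_sum[symmetric])
      (auto intro!: nn_integral_cong simp: sum_distrib_left)
qed

lemma passage_eq: "passage j a i l = exit_now j a i l + jump_op a (passage j a) i l"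
proof -
  have "(\<lambda>n. (jump_op a ^^ Suc n) (exit_now j a) i l) sums jump_op a (passage j a) i l"
    unfolding passage_def by (subst jump_op_suminf) (auto intro: summable_sums)
  from sums_Suc[OF this] show ?thesis
    by (simp add: passage_def[of j a i l] sums_iff add.commute)
qed

lemma exit_now_le:
  assumes "l \<le> a"
  shows "exit_now j a i l = (if i = j then ennreal (exp (- (w + lam i) * (c i * (a - l)))) else 0)"
proof (cases "i = j")
  case True
  have "exit_now j a i l = (\<integral>\<^sup>+s. ennreal (exp (- w * (c i * (a - l)))) * indicator {c i * (a - l)<..} s
      \<partial>exponential_measure (lam i))"
    unfolding exit_now_def exit_weight_def using True c_pos[of i]
    by (intro nn_integral_cong) (auto simp: field_simps split: split_indicator)
  also have "\<dots> = ennreal (exp (- w * (c i * (a - l)))) * ennreal (exp (- lam i * (c i * (a - l))))"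
    using assms c_pos[of i]
    by (subst nn_integral_cmult_indicator)
      (auto simp: emeasure_exponential_greaterThan[OF lam_pos] mult_less_0_iff)
  also have "\<dots> = ennreal (exp (- (w + lam i) * (c i * (a - l))))"
    by (simp add: ennreal_mult'[symmetric] exp_add[symmetric] algebra_simps)
  finally show ?thesis
    using True by simp
qed (simp add: exit_now_def exit_weight_def)

section \<open>Contraction and uniqueness for the renewal equation\<close>

lemma jump_op_mono:
  assumes "\<And>j x. 0 \<le> x \<Longrightarrow> x \<le> a \<Longrightarrow> f j x \<le> g j x" and "0 \<le> l"
  shows "jump_op a f i l \<le> jump_op a g i l"
  unfolding jump_op_def
proof (rule nn_integral_mono_AE, use AE_exponential_nonneg[of "lam i"] in eventually_elim)
  fix s :: real assume "0 \<le> s"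
  have "after_jump f i (l + s / c i) \<le> after_jump g i (l + s / c i)" if "l + s / c i \<le> a"
  proof -
    have nonneg: "0 \<le> l + s / c i"
      using \<open>0 \<le> s\<close> \<open>0 \<le> l\<close> c_pos[of i] by simp
    \<comment> \<open>A jump lowers the level, so after a jump from at most \<open>a\<close> it lies
      in \<open>[0, a]\<close> again, where \<open>f\<close> and \<open>g\<close> can be
      compared.\<close>
    moreover have "p i * (l + s / c i) \<le> l + s / c i"
      using nonneg p_pos[of i] p_less_1[of i] mult_right_mono[of "p i" 1 "l + s / c i"] by simp
    ultimately show ?thesis
      unfolding after_jump_def using that p_pos[of i]
      by (intro sum_mono mult_left_mono assms) auto
  qed
  then show "(if l + s / c i \<le> a then ennreal (exp (- w * s)) * after_jump f i (l + s / c i) else 0)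
      \<le> (if l + s / c i \<le> a then ennreal (exp (- w * s)) * after_jump g i (l + s / c i) else 0)"
    by (auto intro: mult_left_mono)
qed

lemma jump_op_const: "jump_op a (\<lambda>_ _. r) i l \<le> r * ennreal (lam i / (lam i + w))"
proof -
  have "after_jump (\<lambda>_ _. r) i l' = r" for l'
    by (simp only: after_jump_def sum_distrib_right[symmetric] Q_sum mult_1_left)
  then have "jump_op a (\<lambda>_ _. r) i l \<le> (\<integral>\<^sup>+s. r * ennreal (exp (- w * s)) \<partial>exponential_measure (lam i))"
    unfolding jump_op_def
    by (intro nn_integral_mono) (auto simp: mult.commute)
  also have "\<dots> = r * ennreal (lam i / (lam i + w))"
    by (subst nn_integral_cmult) (auto simp: nn_integral_exponential_exp[OF lam_pos w_pos, simplified])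
  finally show ?thesis .
qed

text \<open>By \<open>jump_op_const\<close> the factor for each phase is the Laplace transform of
  its holding time at \<open>w\<close>, which is less than 1. As there are finitely many phases, the
  maximum serves for all of them, and it does not depend on \<open>a\<close>.\<close>

lemma contraction:
  obtains \<rho> where "0 \<le> \<rho>" "\<rho> < 1"
    "\<And>a r i l. jump_op a (\<lambda>_ _. r) i l \<le> r * ennreal \<rho>"
proof
  let ?\<rho> = "Max (range (\<lambda>i. lam i / (lam i + w)))"
  have le: "lam i / (lam i + w) \<le> ?\<rho>" for i
    by (rule Max_ge) auto
  show "0 \<le> ?\<rho>"
    using le[of undefined] lam_pos[of undefined] w_pos
    by (meson add_pos_pos divide_pos_pos less_imp_le order_trans)
  have "lam i / (lam i + w) < 1" for i
    using lam_pos[of i] w_pos by simp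
  then show "?\<rho> < 1"
    by (subst Max_less_iff) auto
  show "jump_op a (\<lambda>_ _. r) i l \<le> r * ennreal ?\<rho>" for a r i l
    using jump_op_const[of a r i l] le[of i]
    by (meson ennreal_leI mult_left_mono order_trans zero_le)
qed

text \<open>A one-sided comparison avoids differences in \<open>ennreal\<close>. Only
  \<open>f\<close> has an a priori bound, and its possible excess over \<open>g\<close> shrinks by
  the factor \<open>\<rho>\<close> with each use of the equation. Applied in both directions this
  gives uniqueness of bounded solutions.\<close>

lemma renewal_le:
  assumes [measurable]: "\<And>i. f i \<in> borel_measurable borel" "\<And>i. g i \<in> borel_measurable borel"
    and f: "\<And>i l. 0 \<le> l \<Longrightarrow> l \<le> a \<Longrightarrow> f i l = b i l + jump_op a f i l"
    and g: "\<And>i l. 0 \<le> l \<Longrightarrow> l \<le> a \<Longrightarrow> g i l = b i l + jump_op a g i l"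
    and bound: "\<And>i l. 0 \<le> l \<Longrightarrow> l \<le> a \<Longrightarrow> f i l \<le> 1"
    and "0 \<le> l" "l \<le> a"
  shows "f i l \<le> g i l"
proof -
  obtain \<rho> where \<rho>: "0 \<le> \<rho>" "\<rho> < 1"
    and contr: "\<And>r i l. jump_op a (\<lambda>_ _. r) i l \<le> r * ennreal \<rho>"
    using contraction by metis
  have step: "f i l \<le> g i l + ennreal (\<rho> ^ n)" if "0 \<le> l" "l \<le> a" for n i l
    using that
  proof (induction n arbitrary: i l)
    case 0
    then show ?case
      using bound[OF 0] by (simp add: add_increasing)
  next
    case (Suc n)
    have "f i l \<le> b i l + jump_op a (\<lambda>i l. g i l + ennreal (\<rho> ^ n)) i l"
      unfolding f[OF Suc.prems] by (intro add_left_mono jump_op_mono Suc)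
    also have "\<dots> = g i l + jump_op a (\<lambda>_ _. ennreal (\<rho> ^ n)) i l"
      by (simp add: jump_op_add g[OF Suc.prems] add.assoc)
    also have "\<dots> \<le> g i l + ennreal (\<rho> ^ n) * ennreal \<rho>"
      by (intro add_left_mono contr)
    also have "\<dots> = g i l + ennreal (\<rho> ^ Suc n)"
      using \<rho> by (simp add: ennreal_mult'[symmetric] mult.commute)
    finally show ?case .
  qed
  have "(\<lambda>n. g i l + ennreal (\<rho> ^ n)) \<longlonglongrightarrow> g i l + ennreal 0"
    using \<rho> by (intro tendsto_add tendsto_const tendsto_ennrealI LIMSEQ_realpow_zero)
  then show ?thesis
    using step[OF \<open>0 \<le> l\<close> \<open>l \<le> a\<close>] by (intro LIMSEQ_le_const[where X = "\<lambda>n. g i l + ennreal (\<rho> ^ n)"]) auto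
qed

text \<open>The holding time running when \<open>y\<close> is passed is memoryless, so it restarts there.\<close>

lemma passage_eq_below:
  assumes "l \<le> y" "y \<le> a"
  shows "passage j a i l =
    ennreal (exp (- (w + lam i) * (c i * (y - l)))) * passage j a i y + jump_op y (passage j a) i l"
proof -
  define h where "h l s = exit_weight j a i l s + (if l + s / c i \<le> a
     then ennreal (exp (- w * s)) * after_jump (passage j a) i (l + s / c i) else 0)" for l s
  have h_measurable [measurable]: "h l \<in> borel_measurable borel" for l
    unfolding h_def exit_weight_def by measurable
  have h: "passage j a i l = (\<integral>\<^sup>+s. h l s \<partial>exponential_measure (lam i))" for l
  proof -
    have [measurable]: "exit_weight j a i l \<in> borel_measurable borel"
      unfolding exit_weight_def by measurable
    show ?thesis
      unfolding h_def passage_eq[of j a i l] exit_now_def jump_op_def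
      by (rule nn_integral_add[symmetric]) measurable
  qed
  \<comment> \<open>The time in which the level climbs from \<open>l\<close> to \<open>y\<close>
    without a jump.\<close>
  define d where "d = c i * (y - l)"
  have d: "0 \<le> d" and below: "l + s / c i \<le> y \<longleftrightarrow> s \<le> d" and shift: "l + (s + d) / c i = y + s / c i" for s
    using assms c_pos[of i] by (auto simp: d_def field_simps)
  \<comment> \<open>Letting the holding time exceed \<open>d\<close> by \<open>s\<close> amounts to
    starting at \<open>y\<close> with holding time \<open>s\<close>, apart from the discount for
    \<open>d\<close>.\<close>
  have h_shift: "h l (s + d) = ennreal (exp (- w * d)) * h y s" for s
  proof -
    have "exp (- w * (c i * (a - l))) = exp (- w * d) * exp (- w * (c i * (a - y)))"
      by (simp add: d_def exp_add[symmetric] algebra_simps)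
    moreover have "exp (- w * (s + d)) = exp (- w * d) * exp (- w * s)"
      by (simp add: exp_add[symmetric] algebra_simps)
    ultimately show ?thesis
      unfolding h_def exit_weight_def shift
      by (auto simp: ennreal_mult' distrib_left mult.assoc)
  qed
  have "h l s = ennreal (exp (- w * s)) * after_jump (passage j a) i (l + s / c i)" if "s \<le> d" for s
    using that below[of s] assms by (simp add: h_def exit_weight_def)
  then have "passage j a i l = (\<integral>\<^sup>+s. (if d < s then h l s else 0) + (if l + s / c i \<le> y
     then ennreal (exp (- w * s)) * after_jump (passage j a) i (l + s / c i) else 0)
     \<partial>exponential_measure (lam i))"
    unfolding h by (intro nn_integral_cong) (simp add: below)
  also have "\<dots> = (\<integral>\<^sup>+s. (if d < s then h l s else 0) \<partial>exponential_measure (lam i)) +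
      jump_op y (passage j a) i l"
    unfolding jump_op_def by (rule nn_integral_add) measurable
  also have "(\<integral>\<^sup>+s. (if d < s then h l s else 0) \<partial>exponential_measure (lam i)) =
      ennreal (exp (- lam i * d)) * (ennreal (exp (- w * d)) * passage j a i y)"
    by (subst nn_integral_exponential_memoryless[OF lam_pos d])
      (auto simp: h_shift nn_integral_cmult h[of y])
  also have "\<dots> = ennreal (exp (- (w + lam i) * d)) * passage j a i y"
  proof -
    have "exp (- (w + lam i) * d) = exp (- lam i * d) * exp (- w * d)"
      by (simp add: exp_add[symmetric] algebra_simps)
    then show ?thesis
      by (simp add: ennreal_mult' mult.assoc)
  qed
  finally show ?thesis
    by (simp add: d_def)
qed

text \<open>The level moves up continuously, so on the way to \<open>a\<close> it first reaches
  \<open>y\<close>, in some phase \<open>k\<close>. Both sides satisfy one renewal equation with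
  barrier \<open>y\<close>, the left one by \<open>passage_eq_below\<close>. The bounds are assumed
  here because they come from the probabilistic meaning of \<open>passage\<close>, established
  later.\<close>

lemma passage_split:
  assumes "0 \<le> x" "x \<le> y" "y \<le> a"
    and bound_a: "\<And>i l. 0 \<le> l \<Longrightarrow> l \<le> a \<Longrightarrow> passage j a i l \<le> 1"
    and bound_y: "\<And>i l. 0 \<le> l \<Longrightarrow> l \<le> y \<Longrightarrow> (\<Sum>k\<in>UNIV. passage k y i l) \<le> 1"
  shows "passage j a i x = (\<Sum>k\<in>UNIV. passage k y i x * passage j a k y)"
proof -
  define g where "g i l = (\<Sum>k\<in>UNIV. passage k y i l * passage j a k y)" for i l
  define b where "b i l = ennreal (exp (- (w + lam i) * (c i * (y - l)))) * passage j a i y" for i l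
  have g_measurable [measurable]: "g i \<in> borel_measurable borel" for i
    unfolding g_def by measurable
  have f: "passage j a i l = b i l + jump_op y (passage j a) i l" if "0 \<le> l" "l \<le> y" for i l
    unfolding b_def using passage_eq_below that assms by blast
  have g: "g i l = b i l + jump_op y g i l" if "0 \<le> l" "l \<le> y" for i l
  proof -
    have "g i l = (\<Sum>k\<in>UNIV. exit_now k y i l * passage j a k y) +
        (\<Sum>k\<in>UNIV. jump_op y (passage k y) i l * passage j a k y)"
      unfolding g_def by (subst passage_eq) (simp add: distrib_right sum.distrib)
    \<comment> \<open>Without a jump the phase is kept, so only \<open>k = i\<close>
      contributes.\<close>
    also have "(\<Sum>k\<in>UNIV. exit_now k y i l * passage j a k y) = b i l"
      unfolding b_def using that by (subst sum.remove[of _ i]) (auto simp: exit_now_le)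
    also have "(\<Sum>k\<in>UNIV. jump_op y (passage k y) i l * passage j a k y) = jump_op y g i l"
      unfolding g_def[abs_def] by (subst jump_op_sum) (auto simp: jump_op_mult_right)
    finally show ?thesis .
  qed
  have g_le: "g i l \<le> 1" if "0 \<le> l" "l \<le> y" for i l
  proof -
    have "g i l \<le> (\<Sum>k\<in>UNIV. passage k y i l * 1)"
      unfolding g_def using assms by (intro sum_mono mult_left_mono bound_a) auto
    also have "\<dots> \<le> 1"
      using bound_y[OF that, of i] by simp
    finally show ?thesis .
  qed
  have f_le: "passage j a i l \<le> 1" if "0 \<le> l" "l \<le> y" for i l
    using bound_a that assms by auto
  have "passage j a i x = g i x"
    using renewal_le[OF passage_measurable g_measurable f g f_le \<open>0 \<le> x\<close> \<open>x \<le> y\<close>]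
      renewal_le[OF g_measurable passage_measurable g f g_le \<open>0 \<le> x\<close> \<open>x \<le> y\<close>]
    by (rule antisym)
  then show ?thesis
    by (simp add: g_def)
qed

end

section \<open>Hitting times of a path\<close>

locale level_path = level_model c lam p Q w
  for c lam p :: "'e::finite \<Rightarrow> real" and Q w +
  fixes T S :: "nat \<Rightarrow> real" and y :: "nat \<Rightarrow> 'e" and X :: "real \<Rightarrow> real" and J :: "real \<Rightarrow> 'e"
    and a :: real
  assumes T_pos: "0 < T n"
    and S_def: "S = (\<lambda>n. \<Sum>k<n. T k)"
    and S_at_top: "filterlim S at_top sequentially"
    and start: "0 \<le> X 0" "X 0 \<le> a"
    and phase: "S n \<le> t \<Longrightarrow> t < S (Suc n) \<Longrightarrow> J t = y n"
    and level: "S n \<le> t \<Longrightarrow> t < S (Suc n) \<Longrightarrow> X t = X (S n) + (t - S n) / c (y n)"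
    and jump: "X (S (Suc n)) = p (y n) * (X (S n) + T n / c (y n))"
begin

text \<open>The left limit of the level at the end of the period; it is not attained by the path.\<close>

abbreviation peak :: "nat \<Rightarrow> real" where
  "peak n \<equiv> X (S n) + T n / c (y n)"

abbreviation hitting_time :: ereal where
  "hitting_time \<equiv> Inf (ereal ` {t. 0 \<le> t \<and> a \<le> X t})"

lemma S_0: "S 0 = 0" and S_Suc: "S (Suc n) = S n + T n"
  by (simp_all add: S_def)

lemma S_mono: "m \<le> n \<Longrightarrow> S m \<le> S n"
  by (rule lift_Suc_mono_le[of S]) (simp_all add: S_Suc T_pos less_imp_le)

lemma level_nonneg: "0 \<le> X (S n)"
proof (induction n)
  case 0
  then show ?case
    using start by (simp add: S_0)
next
  case (Suc n)
  then show ?case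
    using p_pos[of "y n"] c_pos[of "y n"] T_pos[of n] by (simp add: jump)
qed

lemma level_le:
  assumes "\<And>k. k < n \<Longrightarrow> peak k \<le> a"
  shows "X (S n) \<le> a"
proof (cases n)
  case 0
  then show ?thesis
    using start by (simp add: S_0)
next
  case (Suc k)
  have "0 \<le> peak k"
    using level_nonneg[of k] T_pos[of k] c_pos[of "y k"] by simp
  then have "X (S n) \<le> peak k"
    using p_pos[of "y k"] p_less_1[of "y k"] mult_right_mono[of "p (y k)" 1 "peak k"]
    by (simp add: Suc jump)
  also have "\<dots> \<le> a"
    using assms[of k] Suc by simp
  finally show ?thesis .
qed

lemma ex_period:
  assumes "0 \<le> t"
  obtains n where "S n \<le> t" "t < S (Suc n)"
proof -
  obtain m where m: "t < S m"
    using S_at_top by (auto simp: filterlim_at_top_dense eventually_sequentially)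
  define k where "k = (LEAST m. t < S m)"
  have k: "t < S k"
    unfolding k_def using m by (rule LeastI)
  then obtain n where n: "k = Suc n"
    using assms S_0 by (cases k) auto
  have "\<not> t < S n"
    using not_less_Least[of n "\<lambda>m. t < S m"] n by (simp add: k_def)
  then show ?thesis
    using that[of n] k n by simp
qed

lemma below_before_jump:
  assumes "peak n \<le> a" "S n \<le> t" "t < S (Suc n)"
  shows "X t < a"
proof -
  have "(t - S n) / c (y n) < T n / c (y n)"
    using assms(3) c_pos[of "y n"] by (simp add: S_Suc divide_strict_right_mono)
  then show ?thesis
    using assms level[of n t] by simp
qed

lemma hitting_time_infinite:
  assumes "\<And>n. peak n \<le> a"
  shows "hitting_time = \<infinity>"
proof -
  have "\<not> a \<le> X t" if "0 \<le> t" for t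
    using that
  proof (rule ex_period)
    fix n assume "S n \<le> t" "t < S (Suc n)"
    then show ?thesis
      using below_before_jump[OF assms] by (simp add: not_le)
  qed
  then have "{t. 0 \<le> t \<and> a \<le> X t} = {}"
    by auto
  then show ?thesis
    by (simp only: image_empty Inf_empty top_ereal_def)
qed

text \<open>In the first period whose peak exceeds \<open>a\<close>, the level starts at most at
  \<open>a\<close> and rises linearly, so it equals \<open>a\<close> at time \<open>u\<close>; at
  all earlier times it is smaller.\<close>

lemma hitting_time_finite:
  assumes before: "\<And>k. k < n \<Longrightarrow> peak k \<le> a" and at: "a < peak n"
  defines "u \<equiv> S n + c (y n) * (a - X (S n))"
  shows "hitting_time = ereal u" "J u = y n"
proof -
  note c = c_pos[of "y n"]
  have u: "S n \<le> u" "u < S (Suc n)"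
  proof -
    have "0 \<le> c (y n) * (a - X (S n))"
      using level_le[of n] before c by simp
    moreover have "c (y n) * (a - X (S n)) < T n"
      using at c by (simp add: field_simps)
    ultimately show "S n \<le> u" "u < S (Suc n)"
      by (simp_all add: u_def S_Suc)
  qed
  show "J u = y n"
    by (rule phase[OF u])
  have X_u: "X u = a"
    using level[OF u] c by (simp add: u_def)
  have "0 \<le> u"
    using u S_mono[of 0 n] by (simp add: S_0)
  have "u \<le> t" if "0 \<le> t" "a \<le> X t" for t
  proof (rule ccontr)
    assume "\<not> u \<le> t"
    obtain k where k: "S k \<le> t" "t < S (Suc k)"
      using \<open>0 \<le> t\<close> by (rule ex_period)
    \<comment> \<open>Later periods begin after \<open>u\<close>, in period \<open>n\<close> the
      level is strictly increasing, and in earlier ones it stays below \<open>a\<close>.\<close>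
    have "k \<le> n"
      using S_mono[of "Suc n" k] k u \<open>\<not> u \<le> t\<close> by (cases "k \<le> n") auto
    moreover have "k \<noteq> n"
    proof
      assume "k = n"
      then have "(t - S n) / c (y n) < (u - S n) / c (y n)"
        using \<open>\<not> u \<le> t\<close> c by (simp add: divide_strict_right_mono)
      then show False
        using level[OF k] level[OF u] X_u \<open>k = n\<close> \<open>a \<le> X t\<close> by simp
    qed
    ultimately show False
      using below_before_jump[OF before k] \<open>a \<le> X t\<close> by simp
  qed
  then show "hitting_time = ereal u"
    using X_u \<open>0 \<le> u\<close> by (intro antisym Inf_lower Inf_greatest) auto
qed

text \<open>The discount factor up to the \<open>n\<close>-th jump, set to 0 when the peak of a
  previous period exceeds \<open>a\<close>.\<close>

definition discount :: "nat \<Rightarrow> ennreal" where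
  "discount n = (if \<forall>k<n. peak k \<le> a then ennreal (exp (- w * S n)) else 0)"

text \<open>At most one term is nonzero, that of the first period whose peak exceeds
  \<open>a\<close>: before it \<open>exit_weight\<close> vanishes, after it \<open>discount\<close>
  does.\<close>

lemma discounted_hitting_eq:
  "ennreal (if hitting_time < \<infinity> \<and> J (real_of_ereal hitting_time) = j
     then exp (- w * real_of_ereal hitting_time) else 0) =
   (\<Sum>n. discount n * exit_weight j a (y n) (X (S n)) (T n))"
proof (cases "\<forall>n. peak n \<le> a")
  case True
  then have infinite: "hitting_time = \<infinity>"
    by (intro hitting_time_infinite) simp
  have "exit_weight j a (y n) (X (S n)) (T n) = 0" for n
    using True by (simp add: exit_weight_def not_less)
  then show ?thesis
    unfolding infinite by simp
next
  case False
  define n where "n = (LEAST n. a < peak n)"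
  have at: "a < peak n"
    using False LeastI_ex[of "\<lambda>n. a < peak n"] by (auto simp: n_def not_le)
  have before: "peak k \<le> a" if "k < n" for k
    using not_less_Least[of k "\<lambda>n. a < peak n"] that by (simp add: n_def not_less)
  have hit: "hitting_time = ereal (S n + c (y n) * (a - X (S n)))" "J (S n + c (y n) * (a - X (S n))) = y n"
    using hitting_time_finite[of n] before at by blast+
  have zero: "discount k * exit_weight j a (y k) (X (S k)) (T k) = 0" if "k \<noteq> n" for k
  proof (cases "k < n")
    case True
    then show ?thesis
      using before[of k] by (simp add: exit_weight_def)
  next
    case False
    then have "n < k"
      using that by simp
    then have "\<not> (\<forall>k'<k. peak k' \<le> a)"
      using at by (meson not_le)
    then have "discount k = 0"
      unfolding discount_def by (rule if_not_P)
    then show ?thesis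
      by simp
  qed
  have "(\<Sum>k. discount k * exit_weight j a (y k) (X (S k)) (T k)) =
      discount n * exit_weight j a (y n) (X (S n)) (T n)"
    using zero by (subst suminf_finite[of "{n}"]) auto
  also have "\<dots> = (if y n = j
      then ennreal (exp (- w * S n)) * ennreal (exp (- w * (c (y n) * (a - X (S n))))) else 0)"
    using at before by (simp add: discount_def exit_weight_def)
  also have "\<dots> = (if y n = j then ennreal (exp (- w * (S n + c (y n) * (a - X (S n))))) else 0)"
    by (simp add: ennreal_mult'[symmetric] exp_add[symmetric] distrib_left)
  finally show ?thesis
    unfolding hit(1) using hit(2) by simp
qed

end

section \<open>Expectations along the chain of levels and discounts at the jumps\<close>

lemma (in holding_chain) AE_Y_0: "AE \<omega> in M. Y 0 \<omega> = i0"
proof -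
  have "prob {\<omega> \<in> space M. Y 0 \<omega> = i0} = 1"
    using law[of 0 "\<lambda>_. 0" "\<lambda>_. i0"] by (simp add: T_pos cong: conj_cong)
  then show ?thesis
    by (simp add: prob_Collect_eq_1)
qed

locale level_chain = level_model c lam p Q w + jumps: holding_chain M lam Q i0 T Y
  for c lam p :: "'e::finite \<Rightarrow> real" and Q w and M :: "'w measure" and i0 T Y +
  fixes a x :: real
begin

text \<open>The second component of the state is the discount factor at the \<open>n\<close>-th jump, set to 0 once the
  level has exceeded \<open>a\<close>.\<close>

definition step :: "'e \<Rightarrow> (real \<times> ennreal) \<times> real \<Rightarrow> real \<times> ennreal" where
  "step i = (\<lambda>((l, d), t). (p i * (l + t / c i),
     if l + t / c i \<le> a then d * ennreal (exp (- w * t)) else 0))"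

definition level_discount :: "nat \<Rightarrow> 'w \<Rightarrow> real \<times> ennreal" where
  "level_discount n \<omega> = rec_nat (x, 1) (\<lambda>k v. step (Y k \<omega>) (v, T k \<omega>)) n"

sublocale state: recursive_state M lam Q i0 T Y "borel \<Otimes>\<^sub>M borel" "(x, 1)" step level_discount
proof
  show "step i \<in> measurable ((borel \<Otimes>\<^sub>M borel) \<Otimes>\<^sub>M borel) (borel \<Otimes>\<^sub>M borel)" for i
    unfolding step_def split_beta by measurable
qed (auto simp: level_discount_def space_pair_measure)

abbreviation L :: "nat \<Rightarrow> 'w \<Rightarrow> real" where
  "L n \<omega> \<equiv> fst (level_discount n \<omega>)"

abbreviation D :: "nat \<Rightarrow> 'w \<Rightarrow> ennreal" where
  "D n \<omega> \<equiv> snd (level_discount n \<omega>)"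

lemma nn_integral_jump_op:
  assumes [measurable]: "\<And>i. h i \<in> borel_measurable borel"
  shows "(\<integral>\<^sup>+\<omega>. D (Suc n) \<omega> * h (Y (Suc n) \<omega>) (L (Suc n) \<omega>) \<partial>M) =
    (\<integral>\<^sup>+\<omega>. D n \<omega> * jump_op a h (Y n \<omega>) (L n \<omega>) \<partial>M)"
proof -
  define f where "f i j = (\<lambda>((l, d), t).
    d * ((if l + t / c i \<le> a then ennreal (exp (- w * t)) else 0) * h j (p i * (l + t / c i))))" for i j
  have [measurable]: "f i j \<in> borel_measurable ((borel \<Otimes>\<^sub>M borel) \<Otimes>\<^sub>M borel)" for i j
    unfolding f_def split_beta by measurable
  have "(\<integral>\<^sup>+\<omega>. D (Suc n) \<omega> * h (Y (Suc n) \<omega>) (L (Suc n) \<omega>) \<partial>M) =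
      (\<integral>\<^sup>+\<omega>. f (Y n \<omega>) (Y (Suc n) \<omega>) (level_discount n \<omega>, T n \<omega>) \<partial>M)"
    by (intro nn_integral_cong)
      (auto simp: state.V_Suc step_def f_def split_beta mult.assoc)
  also have "\<dots> = (\<integral>\<^sup>+\<omega>. (\<Sum>j\<in>UNIV. ennreal (Q $ Y n \<omega> $ j) *
      (\<integral>\<^sup>+s. f (Y n \<omega>) j (level_discount n \<omega>, s) \<partial>exponential_measure (lam (Y n \<omega>)))) \<partial>M)"
    by (rule state.nn_integral_step) measurable
  also have "\<dots> = (\<integral>\<^sup>+\<omega>. D n \<omega> * jump_op a h (Y n \<omega>) (L n \<omega>) \<partial>M)"
  proof (intro nn_integral_cong)
    fix \<omega>
    obtain i l d where \<omega>: "Y n \<omega> = i" "level_discount n \<omega> = (l, d)"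
      by (cases "level_discount n \<omega>") auto
    have [measurable]: "(\<lambda>s. f i j ((l, d), s)) \<in> borel_measurable borel" for j
      unfolding f_def prod.case by measurable
    have "(\<Sum>j\<in>UNIV. ennreal (Q $ i $ j) * (\<integral>\<^sup>+s. f i j ((l, d), s) \<partial>exponential_measure (lam i))) =
        (\<integral>\<^sup>+s. (\<Sum>j\<in>UNIV. ennreal (Q $ i $ j) * f i j ((l, d), s)) \<partial>exponential_measure (lam i))"
      by (subst nn_integral_sum) (auto simp: nn_integral_cmult)
    also have "\<dots> = (\<integral>\<^sup>+s. d * (if l + s / c i \<le> a
        then ennreal (exp (- w * s)) * after_jump h i (l + s / c i) else 0) \<partial>exponential_measure (lam i))"
      by (intro nn_integral_cong) (simp add: f_def after_jump_def sum_distrib_left mult_ac)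
    also have "\<dots> = d * jump_op a h i l"
      unfolding jump_op_def by (rule nn_integral_cmult) measurable
    finally show "(\<Sum>j\<in>UNIV. ennreal (Q $ Y n \<omega> $ j) *
        (\<integral>\<^sup>+s. f (Y n \<omega>) j (level_discount n \<omega>, s) \<partial>exponential_measure (lam (Y n \<omega>)))) =
        D n \<omega> * jump_op a h (Y n \<omega>) (L n \<omega>)"
      by (simp add: \<omega>)
  qed
  finally show ?thesis .
qed

text \<open>Steps back from \<open>n\<close> to 0, where the state is \<open>(x, 1)\<close> and the
  phase is almost surely \<open>i0\<close>. The induction keeps \<open>h\<close> arbitrary, since
  each step replaces it by \<open>jump_op a h\<close>.\<close>

lemma nn_integral_jump_op_funpow:
  assumes "\<And>i. h i \<in> borel_measurable borel"
  shows "(\<integral>\<^sup>+\<omega>. D n \<omega> * h (Y n \<omega>) (L n \<omega>) \<partial>M) = (jump_op a ^^ n) h i0 x"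
  using assms
proof (induction n arbitrary: h)
  case 0
  have "(\<integral>\<^sup>+\<omega>. D 0 \<omega> * h (Y 0 \<omega>) (L 0 \<omega>) \<partial>M) = (\<integral>\<^sup>+\<omega>. h i0 x \<partial>M)"
    using jumps.AE_Y_0 by (intro nn_integral_cong_AE) (auto simp: state.V_0)
  then show ?case
    by (simp add: jumps.emeasure_space_1)
next
  case (Suc n)
  then show ?case
    by (simp add: nn_integral_jump_op jump_op_measurable funpow_swap1)
qed

lemma nn_integral_exit:
  "(\<integral>\<^sup>+\<omega>. D n \<omega> * exit_weight j a (Y n \<omega>) (L n \<omega>) (T n \<omega>) \<partial>M) = (jump_op a ^^ n) (exit_now j a) i0 x"
proof -
  \<comment> \<open>The argument \<open>j'\<close> for the next phase is a dummy, so averaging over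
    a row of \<open>Q\<close> changes nothing.\<close>
  define f where "f i j' = (\<lambda>((l, d), t). d * exit_weight j a i l t)" for i and j' :: 'e
  have [measurable]: "f i j' \<in> borel_measurable ((borel \<Otimes>\<^sub>M borel) \<Otimes>\<^sub>M borel)" for i j'
    unfolding f_def exit_weight_def split_beta by measurable
  have "(\<integral>\<^sup>+\<omega>. D n \<omega> * exit_weight j a (Y n \<omega>) (L n \<omega>) (T n \<omega>) \<partial>M) =
      (\<integral>\<^sup>+\<omega>. f (Y n \<omega>) (Y (Suc n) \<omega>) (level_discount n \<omega>, T n \<omega>) \<partial>M)"
    by (intro nn_integral_cong) (auto simp: f_def split_beta)
  also have "\<dots> = (\<integral>\<^sup>+\<omega>. (\<Sum>j'\<in>UNIV. ennreal (Q $ Y n \<omega> $ j') *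
      (\<integral>\<^sup>+s. f (Y n \<omega>) j' (level_discount n \<omega>, s) \<partial>exponential_measure (lam (Y n \<omega>)))) \<partial>M)"
    by (rule state.nn_integral_step) measurable
  also have "\<dots> = (\<integral>\<^sup>+\<omega>. D n \<omega> * exit_now j a (Y n \<omega>) (L n \<omega>) \<partial>M)"
  proof (intro nn_integral_cong)
    fix \<omega>
    obtain i l d where \<omega>: "Y n \<omega> = i" "level_discount n \<omega> = (l, d)"
      by (cases "level_discount n \<omega>") auto
    have [measurable]: "exit_weight j a i l \<in> borel_measurable borel"
      unfolding exit_weight_def by measurable
    show "(\<Sum>j'\<in>UNIV. ennreal (Q $ Y n \<omega> $ j') *
        (\<integral>\<^sup>+s. f (Y n \<omega>) j' (level_discount n \<omega>, s) \<partial>exponential_measure (lam (Y n \<omega>)))) =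
        D n \<omega> * exit_now j a (Y n \<omega>) (L n \<omega>)"
      by (simp add: \<omega> f_def nn_integral_cmult exit_now_def sum_distrib_right[symmetric] Q_sum)
  qed
  also have "\<dots> = (jump_op a ^^ n) (exit_now j a) i0 x"
    by (rule nn_integral_jump_op_funpow) measurable
  finally show ?thesis .
qed

end

section \<open>The matrices of first passage\<close>

context level_model
begin

text \<open>On every path the discounted indicator is the series of
  \<open>discounted_hitting_eq\<close>; integrating it termwise gives the Neumann series
  \<open>passage\<close>.\<close>

lemma nn_integral_hitting:
  assumes process: "process_with_jumps c lam p Q x i M X J T Y" and x: "0 \<le> x" "x \<le> a"
  defines "f j \<omega> \<equiv> if tau_up X a \<omega> < \<infinity> \<and> J (real_of_ereal (tau_up X a \<omega>)) \<omega> = j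
    then exp (- w * real_of_ereal (tau_up X a \<omega>)) else 0"
  shows "f j \<in> borel_measurable M" "(\<integral>\<^sup>+\<omega>. ennreal (f j \<omega>) \<partial>M) = passage j a i x"
proof -
  interpret jumps: holding_chain M lam Q i T Y
    using process lam_pos Q_stochastic
    by (auto simp: process_with_jumps_def holding_chain_def holding_chain_axioms_def Let_def)
  interpret level_chain c lam p Q w M i T Y a x
    by unfold_locales
  let ?g = "\<lambda>n \<omega>. D n \<omega> * exit_weight j a (Y n \<omega>) (L n \<omega>) (T n \<omega>)"
  have eq: "ennreal (f j \<omega>) = (\<Sum>n. ?g n \<omega>)" if \<omega>: "\<omega> \<in> space M" for \<omega>
  proof -
    define S where "S = (\<lambda>n. \<Sum>k<n. T k \<omega>)"
    have path: "filterlim S at_top sequentially" "X 0 \<omega> = x"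
      "\<And>n t. S n \<le> t \<Longrightarrow> t < S (Suc n) \<Longrightarrow> J t \<omega> = Y n \<omega>"
      "\<And>n t. S n \<le> t \<Longrightarrow> t < S (Suc n) \<Longrightarrow> X t \<omega> = X (S n) \<omega> + (t - S n) / c (Y n \<omega>)"
      "\<And>n. X (S (Suc n)) \<omega> = p (Y n \<omega>) * (X (S n) \<omega> + T n \<omega> / c (Y n \<omega>))"
      using process \<omega> unfolding process_with_jumps_def Let_def S_def by blast+
    interpret path: level_path c lam p Q w "\<lambda>n. T n \<omega>" S "\<lambda>n. Y n \<omega>" "\<lambda>t. X t \<omega>" "\<lambda>t. J t \<omega>" a
      using path x jumps.T_pos[OF \<omega>] by unfold_locales (auto simp: S_def)
    have "L n \<omega> = X (S n) \<omega> \<and> D n \<omega> = path.discount n" for n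
    proof (induction n)
      case 0
      show ?case
        by (simp add: state.V_0 path.S_0 path(2) path.discount_def)
    next
      case (Suc n)
      have "exp (- w * S (Suc n)) = exp (- w * S n) * exp (- w * T n \<omega>)"
        by (simp add: path.S_Suc exp_add[symmetric] algebra_simps)
      then show ?case
        using Suc
        by (auto simp: state.V_Suc step_def split_beta path.jump path.discount_def All_less_Suc
            ennreal_mult')
    qed
    then show ?thesis
      unfolding f_def tau_up_def path.discounted_hitting_eq by simp
  qed
  have g_measurable [measurable]: "?g n \<in> borel_measurable M" for n
  proof -
    have [measurable]: "(\<lambda>\<omega>. exit_weight j a i' (L n \<omega>) (T n \<omega>)) \<in> borel_measurable M" for i'
      unfolding exit_weight_def by measurable
    have [measurable]: "(\<lambda>\<omega>. exit_weight j a (Y n \<omega>) (L n \<omega>) (T n \<omega>)) \<in> borel_measurable M"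
      by (rule measurable_compose_countable[where f = "\<lambda>i' \<omega>. exit_weight j a i' (L n \<omega>) (T n \<omega>)"])
        measurable
    show ?thesis
      by measurable
  qed
  \<comment> \<open>\<open>tau_up\<close> is an infimum over uncountably many times, so
    measurability is taken from the series, whose terms are measurable.\<close>
  have "f j \<omega> = enn2real (\<Sum>n. ?g n \<omega>)" if "\<omega> \<in> space M" for \<omega>
    unfolding eq[OF that, symmetric] by (simp add: f_def)
  then show "f j \<in> borel_measurable M"
    by (subst measurable_cong) auto
  have "(\<integral>\<^sup>+\<omega>. ennreal (f j \<omega>) \<partial>M) = (\<integral>\<^sup>+\<omega>. (\<Sum>n. ?g n \<omega>) \<partial>M)"
    by (intro nn_integral_cong eq)
  also have "\<dots> = (\<Sum>n. \<integral>\<^sup>+\<omega>. ?g n \<omega> \<partial>M)"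
    by (rule nn_integral_suminf) measurable
  also have "\<dots> = passage j a i x"
    by (simp add: nn_integral_exit passage_def)
  finally show "(\<integral>\<^sup>+\<omega>. ennreal (f j \<omega>) \<partial>M) = passage j a i x" .
qed

lemma tau_up_nonneg: "0 \<le> tau_up X a \<omega>"
  unfolding tau_up_def by (rule Inf_greatest) auto

text \<open>Summed over \<open>j\<close>, the indicators leave the discount factor on the event that
  \<open>a\<close> is reached, which is at most 1.\<close>

lemma passage_sum_le_1:
  assumes process: "process_with_jumps c lam p Q x i M X J T Y" and x: "0 \<le> x" "x \<le> a"
  shows "(\<Sum>j\<in>UNIV. passage j a i x) \<le> 1"
proof -
  interpret prob_space M
    using process by (simp add: process_with_jumps_def)
  let ?f = "\<lambda>j \<omega>. if tau_up X a \<omega> < \<infinity> \<and> J (real_of_ereal (tau_up X a \<omega>)) \<omega> = j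
    then exp (- w * real_of_ereal (tau_up X a \<omega>)) else 0"
  note hitting = nn_integral_hitting[OF assms]
  have "(\<Sum>j\<in>UNIV. passage j a i x) = (\<integral>\<^sup>+\<omega>. (\<Sum>j\<in>UNIV. ennreal (?f j \<omega>)) \<partial>M)"
    using hitting by (subst nn_integral_sum) auto
  also have "\<dots> \<le> (\<integral>\<^sup>+\<omega>. 1 \<partial>M)"
  proof (rule nn_integral_mono)
    fix \<omega>
    have "(\<Sum>j\<in>UNIV. ?f j \<omega>) =
        (if tau_up X a \<omega> < \<infinity> then exp (- w * real_of_ereal (tau_up X a \<omega>)) else 0)"
      by (cases "tau_up X a \<omega> = \<infinity>") simp_all
    also have "\<dots> \<le> 1"
      using w_pos tau_up_nonneg[of X a \<omega>] by (simp add: real_of_ereal_pos)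
    finally show "(\<Sum>j\<in>UNIV. ennreal (?f j \<omega>)) \<le> 1"
      by (subst sum_ennreal) (auto simp: ennreal_le_1)
  qed
  also have "\<dots> = 1"
    by (simp add: emeasure_space_1)
  finally show ?thesis .
qed

end

text \<open>The Levy-Desplanques theorem. For a kernel vector, the row belonging to an entry of
  largest modulus forces that entry to be 0.\<close>

lemma strictly_diagonally_dominant_invertible:
  fixes A :: "real ^ 'n ^ 'n::finite"
  assumes "\<And>i. (\<Sum>j\<in>UNIV - {i}. \<bar>A $ i $ j\<bar>) < \<bar>A $ i $ i\<bar>"
  shows "invertible A"
  unfolding invertible_left_inverse matrix_left_invertible_ker
proof (intro allI impI)
  fix v assume v: "A *v v = 0"
  obtain i where i: "\<bar>v $ j\<bar> \<le> \<bar>v $ i\<bar>" for j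
  proof -
    have "Max (range (\<lambda>j. \<bar>v $ j\<bar>)) \<in> range (\<lambda>j. \<bar>v $ j\<bar>)"
      by (intro Max_in) auto
    then obtain i where "Max (range (\<lambda>j. \<bar>v $ j\<bar>)) = \<bar>v $ i\<bar>"
      by (rule imageE)
    then show ?thesis
      using that[of i] by (metis Max_ge finite rangeI finite_imageI)
  qed
  have "0 = (A *v v) $ i"
    using v by simp
  also have "\<dots> = A $ i $ i * v $ i + (\<Sum>j\<in>UNIV - {i}. A $ i $ j * v $ j)"
    by (simp add: matrix_vector_mult_def sum.remove)
  finally have "\<bar>A $ i $ i\<bar> * \<bar>v $ i\<bar> = \<bar>\<Sum>j\<in>UNIV - {i}. A $ i $ j * v $ j\<bar>"
    by (simp add: abs_mult[symmetric])
  also have "\<dots> \<le> (\<Sum>j\<in>UNIV - {i}. \<bar>A $ i $ j\<bar> * \<bar>v $ i\<bar>)"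
    by (rule order_trans[OF sum_abs sum_mono]) (simp add: abs_mult i mult_left_mono)
  also have "\<dots> = (\<Sum>j\<in>UNIV - {i}. \<bar>A $ i $ j\<bar>) * \<bar>v $ i\<bar>"
    by (simp add: sum_distrib_right)
  finally have "\<bar>v $ i\<bar> \<le> 0"
    using assms[of i] by (metis abs_ge_zero mult_le_cancel_right not_le)
  then show "v = 0"
    using i by (simp add: vec_eq_iff)
qed

section \<open>Multiplicativity and invertibility of the first passage matrices\<close>

locale level_processes = level_model c lam p Q w
  for c lam p :: "'e::finite \<Rightarrow> real" and Q w +
  fixes P :: "real \<Rightarrow> 'e \<Rightarrow> 'w measure" and X :: "real \<Rightarrow> 'w \<Rightarrow> real" and J :: "real \<Rightarrow> 'w \<Rightarrow> 'e"
  assumes process: "0 \<le> x \<Longrightarrow> level_phase_process c lam p Q x i (P x i) X J"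
begin

abbreviation Z :: "real \<Rightarrow> real \<Rightarrow> real ^ 'e ^ 'e" where
  "Z \<equiv> Z_up w P X J"

lemma ennreal_Z:
  assumes "0 \<le> x" "x \<le> a"
  shows "ennreal (Z x a $ i $ j) = passage j a i x"
proof -
  obtain T Y where proc: "process_with_jumps c lam p Q x i (P x i) X J T Y"
    using process[OF assms(1), of i] unfolding level_phase_process_def by blast
  interpret prob_space "P x i"
    using proc by (simp add: process_with_jumps_def)
  let ?f = "\<lambda>\<omega>. if tau_up X a \<omega> < \<infinity> \<and> J (real_of_ereal (tau_up X a \<omega>)) \<omega> = j
    then exp (- w * real_of_ereal (tau_up X a \<omega>)) else 0"
  note hitting = nn_integral_hitting[OF proc assms, of j]
  \<comment> \<open>The Bochner integral in \<open>Z_up\<close> would be 0 by convention for a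
    function that is not integrable; the bound 1 rules this out.\<close>
  have "integrable (P x i) ?f"
    using hitting(1) w_pos tau_up_nonneg[of X a]
    by (intro integrable_const_bound[where B = 1]) (auto simp: real_of_ereal_pos)
  then have "(\<integral>\<^sup>+\<omega>. ennreal (?f \<omega>) \<partial>P x i) = ennreal (\<integral>\<omega>. ?f \<omega> \<partial>P x i)"
    by (rule nn_integral_eq_integral) auto
  then show ?thesis
    using hitting(2) by (simp add: Z_up_def)
qed

lemma Z_nonneg: "0 \<le> Z x a $ i $ j"
  by (auto simp: Z_up_def intro!: integral_nonneg_AE)

lemma sum_passage_le_1:
  assumes "0 \<le> x" "x \<le> a"
  shows "(\<Sum>j\<in>UNIV. passage j a i x) \<le> 1"
  using process[OF assms(1), of i] passage_sum_le_1[OF _ assms] by (auto simp: level_phase_process_def)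

lemma passage_le_1:
  assumes "0 \<le> x" "x \<le> a"
  shows "passage j a i x \<le> 1"
proof -
  have "passage j a i x \<le> (\<Sum>j\<in>UNIV. passage j a i x)"
    by (rule member_le_sum) auto
  then show ?thesis
    using sum_passage_le_1[OF assms] by (rule order_trans)
qed

lemma Z_mult:
  assumes "0 \<le> x" "x \<le> y" "y \<le> a"
  shows "Z x a = Z x y ** Z y a"
proof -
  have "ennreal (Z x a $ i $ j) = ennreal (\<Sum>k\<in>UNIV. Z x y $ i $ k * Z y a $ k $ j)" for i j
  proof -
    have "ennreal (Z x a $ i $ j) = (\<Sum>k\<in>UNIV. passage k y i x * passage j a k y)"
      using assms by (subst passage_split[symmetric]) (auto simp: ennreal_Z passage_le_1 sum_passage_le_1)
    also have "\<dots> = (\<Sum>k\<in>UNIV. ennreal (Z x y $ i $ k * Z y a $ k $ j))"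
      using assms by (simp add: ennreal_Z[symmetric] ennreal_mult Z_nonneg)
    also have "\<dots> = ennreal (\<Sum>k\<in>UNIV. Z x y $ i $ k * Z y a $ k $ j)"
      by (rule sum_ennreal) (simp add: Z_nonneg)
    finally show ?thesis .
  qed
  then have "Z x a $ i $ j = (\<Sum>k\<in>UNIV. Z x y $ i $ k * Z y a $ k $ j)" for i j
    by (subst (asm) ennreal_inj) (auto intro!: sum_nonneg simp: Z_nonneg)
  then show ?thesis
    by (simp add: vec_eq_iff matrix_matrix_mult_def)
qed

text \<open>Keeps only the contribution of reaching \<open>a\<close> before the first jump.\<close>

lemma Z_diagonal_ge:
  assumes "0 \<le> x" "x \<le> a"
  shows "exp (- (w + lam i) * (c i * (a - x))) \<le> Z x a $ i $ i"
proof -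
  have "ennreal (exp (- (w + lam i) * (c i * (a - x)))) \<le> ennreal (Z x a $ i $ i)"
    unfolding ennreal_Z[OF assms] by (subst passage_eq) (simp add: exit_now_le assms)
  then show ?thesis
    by (simp add: Z_nonneg)
qed

lemma Z_row_sum_le:
  assumes "0 \<le> x" "x \<le> a"
  shows "(\<Sum>j\<in>UNIV. Z x a $ i $ j) \<le> 1"
proof -
  have "ennreal (\<Sum>j\<in>UNIV. Z x a $ i $ j) \<le> 1"
    using sum_passage_le_1[OF assms, of i] by (simp add: ennreal_Z[OF assms, symmetric] Z_nonneg)
  then show ?thesis
    by (simp add: ennreal_le_1)
qed

lemma Z_invertible_close:
  obtains r where "0 < r" "\<And>x a. 0 \<le> x \<Longrightarrow> x \<le> a \<Longrightarrow> a - x \<le> r \<Longrightarrow> invertible (Z x a)"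
proof
  define K where "K = (\<Sum>i\<in>UNIV. (w + lam i) * c i)"
  have le_K: "(w + lam i) * c i \<le> K" for i
    unfolding K_def using w_pos lam_pos c_pos
    by (intro member_le_sum) (auto intro!: less_imp_le mult_pos_pos add_pos_pos)
  have "0 < (w + lam undefined) * c undefined"
    using w_pos lam_pos[of undefined] c_pos[of undefined] by simp
  then have "0 < K"
    using le_K[of undefined] by simp
  \<comment> \<open>For \<open>a - x\<close> up to this length the exponent is at most
    \<open>ln 2 / 2\<close> in absolute value, so each diagonal entry exceeds 1/2, and the bound on
    the row sums leaves less than 1/2 for the rest of the row.\<close>
  show "0 < ln 2 / (2 * K)"
    using \<open>0 < K\<close> by simp
  fix x a assume xa: "0 \<le> x" "x \<le> a" and close: "a - x \<le> ln 2 / (2 * K)"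
  show "invertible (Z x a)"
  proof (rule strictly_diagonally_dominant_invertible)
    fix i
    have "(w + lam i) * (c i * (a - x)) \<le> K * (ln 2 / (2 * K))"
      using le_K[of i] close xa \<open>0 < K\<close> mult_mono[of "(w + lam i) * c i" K "a - x" "ln 2 / (2 * K)"]
      by (simp add: mult.assoc)
    also have "\<dots> < ln 2"
      using \<open>0 < K\<close> by simp
    finally have "exp (- ln 2) < exp (- (w + lam i) * (c i * (a - x)))"
      unfolding mult_minus_left by simp
    then have "1 / 2 < Z x a $ i $ i"
      using Z_diagonal_ge[OF xa, of i] by (simp add: exp_minus)
    moreover have "Z x a $ i $ i + (\<Sum>j\<in>UNIV - {i}. Z x a $ i $ j) \<le> 1"
      using Z_row_sum_le[OF xa, of i] by (simp add: sum.remove[of _ i])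
    ultimately show "(\<Sum>j\<in>UNIV - {i}. \<bar>Z x a $ i $ j\<bar>) < \<bar>Z x a $ i $ i\<bar>"
      by (simp add: Z_nonneg)
  qed
qed

lemma Z_0_invertible:
  assumes "0 \<le> x"
  shows "invertible (Z 0 x)"
proof -
  obtain r where "0 < r" and close: "\<And>x a. 0 \<le> x \<Longrightarrow> x \<le> a \<Longrightarrow> a - x \<le> r \<Longrightarrow> invertible (Z x a)"
    using Z_invertible_close by blast
  obtain n :: nat where "x / r < real n"
    using reals_Archimedean2 by blast
  then have "x \<le> real n * r"
    using \<open>0 < r\<close> by (simp add: field_simps)
  then show ?thesis
    using assms
  proof (induction n arbitrary: x)
    case 0
    then show ?case
      using close[of 0 0] \<open>0 < r\<close> by simp
  next
    case (Suc n)
    \<comment> \<open>Cuts off a last step of length at most \<open>r\<close>; the maximum keeps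
      \<open>y\<close> nonnegative.\<close>
    define y where "y = max 0 (x - r)"
    have y: "0 \<le> y" "y \<le> x" "x - y \<le> r" "y \<le> real n * r"
      using Suc.prems \<open>0 < r\<close> by (auto simp: y_def algebra_simps)
    have "invertible (Z 0 y ** Z y x)"
      using y by (intro invertible_mult Suc.IH close)
    then show ?case
      using Z_mult[of 0 y x] y by simp
  qed
qed

end

theorem theorem3p1:
  fixes c lam p :: "'e::finite \<Rightarrow> real"
    and Q :: "real ^ 'e ^ 'e"
    and w :: real
    and P :: "real \<Rightarrow> 'e \<Rightarrow> 'w measure"
    and X :: "real \<Rightarrow> 'w \<Rightarrow> real"
    and J :: "real \<Rightarrow> 'w \<Rightarrow> 'e"
  assumes "\<And>i. c i > 0"
    and "\<And>i. lam i > 0"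
    and "\<And>i. 0 < p i \<and> p i < 1"
    and "stochastic_matrix Q"
    and "w > 0"
    and "\<And>x i. x \<ge> 0 \<Longrightarrow> level_phase_process c lam p Q x i (P x i) X J"
  shows "(\<forall>x\<ge>0. invertible (Z_up w P X J 0 x)) \<and>
         (\<forall>x a. 0 \<le> x \<and> x \<le> a \<longrightarrow>
            Z_up w P X J x a = matrix_inv (Z_up w P X J 0 x) ** Z_up w P X J 0 a)"
proof -
  interpret level_processes c lam p Q w P X J
    using assms by unfold_locales auto
  have "Z x a = matrix_inv (Z 0 x) ** Z 0 a" if "0 \<le> x" "x \<le> a" for x a
  proof -
    have "matrix_inv (Z 0 x) ** Z 0 x = mat 1"
      using Z_0_invertible[OF \<open>0 \<le> x\<close>] someI_ex[of "\<lambda>B. Z 0 x ** B = mat 1 \<and> B ** Z 0 x = mat 1"]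
      by (simp add: invertible_def matrix_inv_def)
    then show ?thesis
      using Z_mult[of 0 x a] that by (simp add: matrix_mul_assoc)
  qed
  then show ?thesis
    using Z_0_invertible by blast
qed

end
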